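(* Let $(\mathcal H,\langle\cdot,\cdot\rangle,\|\cdot\|)$ be a separable Hilbert space, $\Psi:\mathcal H\to\mathcal H$, $u_0\in\mathcal H$, and let the signal be $u_j=\Psi(u_{j-1})$, $j\ge 1$. Let $H:\mathcal H\to\mathbb R^k$ be linear with $HH^*=I_k$, set $P:=H^*H$, and let the observations be $y_j=Hu_j+\varepsilon\eta_j$, $j\ge1$, with $\varepsilon>0$ and $\eta_j$ independent random vectors in $\mathbb R^k$ with $\mathbb E[\eta_j]=0$ and $\mathrm{Cov}[\eta_j]=R$. Suppose $\Psi$ and $H$ satisfy Assumption A (see context) and that $N\ge 6k$. Let $\widehat m_j$ be the means output by the square-root ensemble Kalman filter (Algorithm EnKF in the context) with $N$ particles and covariance inflation $Q=aP$. Then, if the inflation parameter $a>0$ is sufficiently large, there is a constant $\mathsf C$ independent of $\varepsilon$ such that $$\limsup_{j\to\infty}\mathbb E\|\widehat m_j-u_j\|\le \mathsf C\varepsilon .$$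
   Context: For $\beta\ge0$ define $V(u):=(\|u\|^2+\beta\|Pu\|^2)^{1/2}$; $P$ is an orthogonal projection onto a $k$-dimensional subspace of $\mathcal H$. Assumption A: there exist $r>0$, $\beta\ge 0$, $L>0$, $\alpha\in(0,1)$ such that (i) the ball $\mathcal B=\{u\in\mathcal H:\|u\|\le r\}$ is absorbing and forward invariant for the dynamics $u\mapsto\Psi(u)$; (ii) $V^2(\Psi(u)-\Psi(v))\le L\,V^2(u-v)$ for all $u,v\in\mathcal B$; (iii) (squeezing) $V^2\big((I-P)(\Psi(u)-\Psi(v))\big)\le\alpha V^2(u-v)$ for all $u,v\in\mathcal B$. $P_{\mathcal B_V}$ denotes the orthogonal projection onto $\mathcal B$ with respect to the $V$-norm. The Kalman gain of a covariance operator $\Sigma$ is $\mathscr K(\Sigma):=\Sigma H^*(H\Sigma H^*+\varepsilon^2R)^{-1}$. Algorithm EnKF (square-root ensemble Kalman filter): draw $u_0^{(n)}\overset{iid}{\sim}\mathcal N(m_0,C_0)$, $1\le n\le N$, for given $m_0\in\mathcal H$ and covariance operator $C_0$. For $j=1,2,\dots$: prediction $v_j^{(n)}=\Psi(P_{\mathcal B_V}u_{j-1}^{(n)})+\xi_j^{(n)}$ with $\xi_j^{(n)}\overset{iid}{\sim}\mathcal N(0,Q)$, $Q=aP$, independent of everything else; $\widehat\mu_j=\frac1N\sum_n v_j^{(n)}$, $\widehat\Sigma_j=\frac1N\sum_n(v_j^{(n)}-\widehat\mu_j)\otimes(v_j^{(n)}-\widehat\mu_j)$; analysis: transform $\{v_j^{(n)}\}$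 into any ensemble $\{u_j^{(n)}\}$ such that $\widehat m_j:=\frac1N\sum_n u_j^{(n)}=\widehat\mu_j+\mathscr K(\widehat\Sigma_j)(y_j-H\widehat\mu_j)$ and $\widehat C_j:=\frac1{N-1}\sum_n(u_j^{(n)}-\widehat m_j)\otimes(u_j^{(n)}-\widehat m_j)=(I-\mathscr K(\widehat\Sigma_j)H)\widehat\Sigma_j$. Expectations are over all randomness (observation noise, initial ensemble, inflation noise). *)

theory Defs
  imports "HOL-Probability.Probability"
begin

definition Vnorm :: "real \<Rightarrow> ('h::real_normed_vector \<Rightarrow> 'h) \<Rightarrow> 'h \<Rightarrow> real" where
  "Vnorm \<beta> P u = sqrt ((norm u)^2 + \<beta> * (norm (P u))^2)"

definition absorbing_forward_invariant :: "('h::real_normed_vector \<Rightarrow> 'h) \<Rightarrow> 'h set \<Rightarrow> bool" where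
  "absorbing_forward_invariant \<Psi> B \<longleftrightarrow>
     \<Psi> ` B \<subseteq> B \<and> (\<forall>D. bounded D \<longrightarrow> (\<exists>T. \<forall>n\<ge>T. (\<Psi> ^^ n) ` D \<subseteq> B))"

definition assumption_A ::
  "('h::real_normed_vector \<Rightarrow> 'h) \<Rightarrow> ('h \<Rightarrow> 'h) \<Rightarrow> real \<Rightarrow> real \<Rightarrow> real \<Rightarrow> real \<Rightarrow> bool" where
  "assumption_A \<Psi> P r \<beta> L \<alpha> \<longleftrightarrow>
     r > 0 \<and> \<beta> \<ge> 0 \<and> L > 0 \<and> 0 < \<alpha> \<and> \<alpha> < 1 \<and>
     absorbing_forward_invariant \<Psi> (cball 0 r) \<and>
     (\<forall>u\<in>cball 0 r. \<forall>v\<in>cball 0 r.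
        (Vnorm \<beta> P (\<Psi> u - \<Psi> v))^2 \<le> L * (Vnorm \<beta> P (u - v))^2) \<and>
     (\<forall>u\<in>cball 0 r. \<forall>v\<in>cball 0 r.
        (Vnorm \<beta> P ((\<Psi> u - \<Psi> v) - P (\<Psi> u - \<Psi> v)))^2 \<le> \<alpha> * (Vnorm \<beta> P (u - v))^2)"

definition proj_BV :: "real \<Rightarrow> real \<Rightarrow> ('h::real_normed_vector \<Rightarrow> 'h) \<Rightarrow> 'h \<Rightarrow> 'h" where
  "proj_BV r \<beta> P u =
     (THE w. w \<in> cball 0 r \<and> (\<forall>w'\<in>cball 0 r. Vnorm \<beta> P (u - w) \<le> Vnorm \<beta> P (u - w')))"

definition emp_mean :: "nat \<Rightarrow> (nat \<Rightarrow> 'h::real_vector) \<Rightarrow> 'h" where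
  "emp_mean N v = (1 / real N) *\<^sub>R (\<Sum>n<N. v n)"

definition outer_sum :: "nat \<Rightarrow> (nat \<Rightarrow> 'h::real_inner) \<Rightarrow> 'h \<Rightarrow> 'h \<Rightarrow> 'h" where
  "outer_sum N v m x = (\<Sum>n<N. inner (v n - m) x *\<^sub>R (v n - m))"

definition kalman_gain ::
  "('h::real_inner \<Rightarrow> real^'k) \<Rightarrow> (real^'k \<Rightarrow> 'h) \<Rightarrow> real^'k^'k \<Rightarrow> real \<Rightarrow> ('h \<Rightarrow> 'h)
     \<Rightarrow> real^'k \<Rightarrow> 'h" where
  "kalman_gain H Hadj R \<epsilon> \<Sigma> z =
     (let S = (\<chi> i j. (H (\<Sigma> (Hadj (axis j 1)))) $ i) + (\<epsilon>^2) *\<^sub>R R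
      in \<Sigma> (Hadj (matrix_inv S *v z)))"

definition real_gaussian :: "real \<Rightarrow> real \<Rightarrow> real measure" where
  "real_gaussian \<mu> s2 =
     (if s2 = 0 then return borel \<mu> else density lborel (normal_density \<mu> (sqrt s2)))"

definition gaussian_rv :: "'a measure \<Rightarrow> ('a \<Rightarrow> 'h::real_inner) \<Rightarrow> 'h \<Rightarrow> ('h \<Rightarrow> 'h) \<Rightarrow> bool" where
  "gaussian_rv M X m C \<longleftrightarrow> X \<in> borel_measurable M \<and>
     (\<forall>h. distr M borel (\<lambda>\<omega>. inner (X \<omega>) h) = real_gaussian (inner m h) (inner (C h) h))"

datatype src = Init nat | Infl nat nat | Obs nat

definition enkf_index :: "nat \<Rightarrow> src set" where
  "enkf_index N = {Init n | n. n < N} \<union> {Infl j n | j n. 1 \<le> j \<and> n < N} \<union> {Obs j | j. 1 \<le> j}"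

definition enkf_sigma ::
  "'a measure \<Rightarrow> (nat \<Rightarrow> 'a \<Rightarrow> 'h::topological_space) \<Rightarrow> (nat \<Rightarrow> nat \<Rightarrow> 'a \<Rightarrow> real^'k)
     \<Rightarrow> (nat \<Rightarrow> 'a \<Rightarrow> real^'k) \<Rightarrow> src \<Rightarrow> 'a set set" where
  "enkf_sigma M U0 \<zeta> \<eta> s = (case s of
      Init n \<Rightarrow> {U0 n -` A \<inter> space M | A. A \<in> sets borel}
    | Infl j n \<Rightarrow> {\<zeta> j n -` A \<inter> space M | A. A \<in> sets borel}
    | Obs j \<Rightarrow> {\<eta> j -` A \<inter> space M | A. A \<in> sets borel})"

text \<open>U j n \<omega> is the n-th analysis ensemble member at step j (U 0 = initial ensemble).
  The inflation noise is xi_j^(n) = sqrt a * H^* zeta_j^(n) with zeta standard normal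
  in R^k, so xi ~ N(0, aP).  The analysis step may produce any ensemble with the
  prescribed mean and covariance.\<close>
definition enkf_run ::
  "('h::real_inner \<Rightarrow> 'h) \<Rightarrow> ('h \<Rightarrow> real^'k) \<Rightarrow> (real^'k \<Rightarrow> 'h) \<Rightarrow> real^'k^'k
     \<Rightarrow> real \<Rightarrow> real \<Rightarrow> nat \<Rightarrow> real \<Rightarrow> real \<Rightarrow> 'a measure
     \<Rightarrow> (nat \<Rightarrow> 'a \<Rightarrow> 'h) \<Rightarrow> (nat \<Rightarrow> nat \<Rightarrow> 'a \<Rightarrow> real^'k) \<Rightarrow> (nat \<Rightarrow> 'a \<Rightarrow> real^'k)
     \<Rightarrow> (nat \<Rightarrow> nat \<Rightarrow> 'a \<Rightarrow> 'h) \<Rightarrow> bool" where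
  "enkf_run \<Psi> H Hadj R r \<beta> N a \<epsilon> M U0 \<zeta> y U \<longleftrightarrow>
     (\<forall>n<N. \<forall>\<omega>\<in>space M. U 0 n \<omega> = U0 n \<omega>) \<and>
     (\<forall>j n. n < N \<longrightarrow> U j n \<in> borel_measurable M) \<and>
     (\<forall>j\<ge>1. \<forall>\<omega>\<in>space M.
        let v = (\<lambda>n. \<Psi> (proj_BV r \<beta> (Hadj \<circ> H) (U (j - 1) n \<omega>)) + sqrt a *\<^sub>R Hadj (\<zeta> j n \<omega>));
            \<mu> = emp_mean N v;
            \<Sigma> = (\<lambda>x. (1 / real N) *\<^sub>R outer_sum N v \<mu> x);
            K = kalman_gain H Hadj R \<epsilon> \<Sigma>;
            m = emp_mean N (\<lambda>n. U j n \<omega>)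
        in m = \<mu> + K (y j \<omega> - H \<mu>) \<and>
           (\<forall>x. (1 / real (N - 1)) *\<^sub>R outer_sum N (\<lambda>n. U j n \<omega>) m x = \<Sigma> x - K (H (\<Sigma> x))))"

end

theory Submission
  imports Defs
begin

text \<open>
  The \<open>V\<close>-norm is the pull-back of a Hilbert norm under \<open>u \<mapsto> (u, sqrt \<beta> P u)\<close>, so spreads and projections
  can be treated in an ordinary inner product space.  The filter is controlled by two quantities: the
  \<open>V\<close>-spread \<open>S\<close> of the analysis ensemble and the \<open>V\<close>-error \<open>X\<close> of its mean.  The recursion is triangular.
  Pathwise, squeezing and the covariance update give \<open>S' \<le> \<alpha> S + C \<epsilon>\<^sup>2\<close>, so that \<open>S = O(\<epsilon>\<^sup>2)\<close> eventually.
  The error then satisfies \<open>X' \<le> sqrt \<alpha> X + \<epsilon> Y\<close>, where \<open>Y\<close> is a polynomial in the noises and in a random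
  variable \<open>W\<close> bounding the inverse of the Gram matrix of the inflation noise.  As the drift of the
  forecast is of size \<open>sqrt S = O(\<epsilon>)\<close>, it is absorbed by \<open>\<epsilon>\<^sup>2 R\<close> in the innovation covariance, and the
  Gram matrix can be estimated without using how the ensemble depends on the inflation noise.  Finally
  \<open>6 k\<close> particles contain three independent \<open>k \<times> k\<close> blocks of Gaussian differences, and since each
  smallest singular value \<open>\<sigma>\<close> has \<open>P(\<sigma> \<le> t) = O(t)\<close>, the inverse square of the largest of the three is
  integrable.
\<close>

section \<open>Ensemble spreads and weighted projections\<close>

text \<open>The obstacle is a random gain acting on an innovation of order one. The bound
  \<open>\<epsilon>\<^sup>2 * \<rho>\<close> on the innovation covariance alone would leave an error
  of order one at each step, and a random gain multiplying the old error would tie the error to the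
  ensemble. Truncation to the ball settles the second point: the innovation is bounded by
  \<open>r\<close> and the current noises, so the random factor multiplies no earlier error, and
  expectations pass through the recursion by linearity. The independence that matters is that of the
  inflation noises within one step. For the first point, one square Gaussian block does not suffice:
  its inverse smallest singular value fails, logarithmically, to be integrable. Three blocks leave
  room, since the exponent 2/3 is integrable in each block and the product of three such factors has
  exponent 2. A block has k rows, and each row is a difference of two particles, which removes the
  unknown ensemble mean; this is the count 6 k.\<close>

lemma norm_sq_diff: "(norm (x - y :: 'a::real_inner))\<^sup>2 = (norm x)\<^sup>2 - 2 * inner x y + (norm y)\<^sup>2"
  by (simp add: power2_norm_eq_inner inner_diff inner_commute)

lemma norm_sq_add: "(norm (x + y :: 'a::real_inner))\<^sup>2 = (norm x)\<^sup>2 + 2 * inner x y + (norm y)\<^sup>2"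
  by (simp add: power2_norm_eq_inner inner_add inner_commute)

lemma emp_mean_linear:
  assumes "linear f" shows "emp_mean N (\<lambda>n. f (v n)) = f (emp_mean N v)"
  by (simp add: emp_mean_def linear_scale[OF assms] linear_sum[OF assms])

lemma emp_mean_add: "emp_mean N (\<lambda>n. v n + w n) = emp_mean N v + emp_mean N w"
  by (simp add: emp_mean_def sum.distrib scaleR_add_right)

lemma emp_mean_diff_const:
  "N > 0 \<Longrightarrow> emp_mean N (\<lambda>n. v n - c) = emp_mean N v - c"
  by (simp add: emp_mean_def sum_subtractf scaleR_diff_right sum_constant_scaleR)

lemma norm_emp_mean_le:
  fixes v :: "nat \<Rightarrow> 'a::real_normed_vector"
  shows "norm (emp_mean N v) \<le> (1 / real N) * (\<Sum>n<N. norm (v n))"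
proof -
  have "norm (emp_mean N v) = (1 / real N) * norm (\<Sum>n<N. v n)"
    by (simp add: emp_mean_def)
  also have "\<dots> \<le> (1 / real N) * (\<Sum>n<N. norm (v n))"
    by (intro mult_left_mono norm_sum) auto
  finally show ?thesis .
qed

lemma sum_norm_sq_shift:
  fixes v :: "nat \<Rightarrow> 'a::real_inner"
  assumes "N > 0"
  shows "(\<Sum>n<N. (norm (v n - c))\<^sup>2)
    = (\<Sum>n<N. (norm (v n - emp_mean N v))\<^sup>2) + real N * (norm (emp_mean N v - c))\<^sup>2"
proof -
  let ?m = "emp_mean N v"
  have z: "(\<Sum>n<N. inner (v n - ?m) (?m - c)) = 0"
    using assms by (simp add: inner_sum_left [symmetric] sum_subtractf emp_mean_def sum_constant_scaleR
        del: inner_diff_left inner_diff_right)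
  have "(norm (v n - c))\<^sup>2 = (norm (v n - ?m))\<^sup>2 + 2 * inner (v n - ?m) (?m - c) + (norm (?m - c))\<^sup>2" for n
    using norm_sq_add[of "v n - ?m" "?m - c"] by simp
  then show ?thesis
    by (simp add: sum.distrib sum_distrib_left[symmetric] z)
qed

lemma sum_norm_sq_emp_mean_le:
  fixes v :: "nat \<Rightarrow> 'a::real_inner"
  assumes "N > 0"
  shows "(\<Sum>n<N. (norm (v n - emp_mean N v))\<^sup>2) \<le> (\<Sum>n<N. (norm (v n - c))\<^sup>2)"
  using sum_norm_sq_shift[OF assms, of v c] by simp

lemma sum_norm_sq_pairs:
  fixes v :: "nat \<Rightarrow> 'a::real_inner"
  assumes "N > 0"
  shows "(\<Sum>m<N. \<Sum>n<N. (norm (v n - v m))\<^sup>2)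
    = 2 * real N * (\<Sum>n<N. (norm (v n - emp_mean N v))\<^sup>2)"
proof -
  have "(\<Sum>m<N. \<Sum>n<N. (norm (v n - v m))\<^sup>2)
    = (\<Sum>m<N. (\<Sum>n<N. (norm (v n - emp_mean N v))\<^sup>2) + real N * (norm (v m - emp_mean N v))\<^sup>2)"
    by (rule sum.cong[OF refl])
       (subst sum_norm_sq_shift[OF assms], simp add: norm_minus_commute)
  then show ?thesis by (simp add: sum.distrib sum_distrib_left[symmetric])
qed

text \<open>The spread is, up to the factor 2 N, the sum of squared pairwise distances, so a bound
  on pairs transfers without comparing the mean of the images with the image of the mean.\<close>

lemma spread_contraction:
  fixes x :: "nat \<Rightarrow> 'a::real_inner" and y :: "nat \<Rightarrow> 'b::real_inner"
  assumes "N > 0"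
    and "\<And>n m. n < N \<Longrightarrow> m < N \<Longrightarrow> (norm (x n - x m))\<^sup>2 \<le> q * (norm (y n - y m))\<^sup>2"
  shows "(\<Sum>n<N. (norm (x n - emp_mean N x))\<^sup>2) \<le> q * (\<Sum>n<N. (norm (y n - emp_mean N y))\<^sup>2)"
proof -
  have "(\<Sum>m<N. \<Sum>n<N. (norm (x n - x m))\<^sup>2) \<le> (\<Sum>m<N. \<Sum>n<N. q * (norm (y n - y m))\<^sup>2)"
    using assms(2) by (intro sum_mono) auto
  also have "\<dots> = q * (\<Sum>m<N. \<Sum>n<N. (norm (y n - y m))\<^sup>2)"
    by (simp add: sum_distrib_left)
  finally show ?thesis
    using assms(1) by (simp add: sum_norm_sq_pairs mult.left_commute mult_le_cancel_left_pos)
qed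

text \<open>Monotonicity of the trace under the order of quadratic forms. All the vectors lie in one
  finite-dimensional span, so the trace may be taken over an orthonormal basis of that span even
  when the ambient space is infinite-dimensional.\<close>

lemma sum_norm_sq_le_of_forms:
  fixes a d :: "nat \<Rightarrow> 'a::real_inner"
  assumes q: "q \<ge> 0" and forms: "\<And>x. (\<Sum>n<N. (inner (a n) x)\<^sup>2) \<le> q * (\<Sum>n<N. (inner (d n) x)\<^sup>2)"
  shows "(\<Sum>n<N. (norm (a n))\<^sup>2) \<le> q * (\<Sum>n<N. (norm (d n))\<^sup>2)"
proof -
  obtain C where C: "finite C" "span C = span (a ` {..<N} \<union> d ` {..<N})" "pairwise orthogonal C"
    using basis_orthogonal[of "a ` {..<N} \<union> d ` {..<N}"] by auto
  define B where "B = (\<lambda>x. x /\<^sub>R norm x) ` (C - {0})"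
  have fB: "finite B" using C by (simp add: B_def)
  have oB: "inner b b' = (if b = b' then 1 else 0)" if bb: "b \<in> B" "b' \<in> B" for b b'
  proof -
    obtain c c' where c: "c \<in> C" "c \<noteq> 0" "b = c /\<^sub>R norm c" and c': "c' \<in> C" "c' \<noteq> 0" "b' = c' /\<^sub>R norm c'"
      using bb by (auto simp: B_def)
    show ?thesis
    proof (cases "c = c'")
      case True
      then show ?thesis using c c' by (simp add: norm_eq_1[symmetric] dot_square_norm power2_eq_square)
    next
      case False
      then have "inner c c' = 0" using C(3) c c' by (auto simp: pairwise_def orthogonal_def)
      then have "inner b b' = 0" using c c' by simp
      moreover have "inner b b = 1" using c by (simp add: dot_square_norm power2_eq_square)
      ultimately show ?thesis by auto
    qed
  qed
  have "C \<subseteq> span B"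
  proof
    fix c assume "c \<in> C"
    show "c \<in> span B"
    proof (cases "c = 0")
      case False
      then have "c /\<^sub>R norm c \<in> span B" using \<open>c \<in> C\<close> by (intro span_base) (auto simp: B_def)
      then have "norm c *\<^sub>R (c /\<^sub>R norm c) \<in> span B" by (rule span_scale)
      then show ?thesis using False by simp
    qed (auto simp: span_zero)
  qed
  then have "span C \<subseteq> span B" by (simp add: span_minimal)
  have parseval: "(norm x)\<^sup>2 = (\<Sum>b\<in>B. (inner x b)\<^sup>2)" if "x \<in> span C" for x
  proof -
    have "x \<in> span B" using that \<open>span C \<subseteq> span B\<close> by auto
    then obtain u where x: "x = (\<Sum>b\<in>B. u b *\<^sub>R b)" using span_finite[OF fB] by auto
    have ib: "inner x b = u b" if "b \<in> B" for b
      using that fB by (simp add: x inner_sum_left oB if_distrib cong: if_cong)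
    have "(norm x)\<^sup>2 = inner x (\<Sum>b\<in>B. u b *\<^sub>R b)" by (simp add: power2_norm_eq_inner x[symmetric])
    also have "\<dots> = (\<Sum>b\<in>B. u b * inner x b)" by (simp add: inner_sum_right)
    also have "\<dots> = (\<Sum>b\<in>B. (inner x b)\<^sup>2)" by (rule sum.cong) (auto simp: ib power2_eq_square)
    finally show ?thesis .
  qed
  have mem: "a n \<in> span C" "d n \<in> span C" if "n < N" for n
    using that by (auto simp: C(2) intro!: span_base)
  have "(\<Sum>n<N. (norm (a n))\<^sup>2) = (\<Sum>n<N. \<Sum>b\<in>B. (inner (a n) b)\<^sup>2)"
    using mem by (intro sum.cong) (auto simp: parseval)
  also have "\<dots> = (\<Sum>b\<in>B. \<Sum>n<N. (inner (a n) b)\<^sup>2)" by (rule sum.swap)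
  also have "\<dots> \<le> (\<Sum>b\<in>B. q * (\<Sum>n<N. (inner (d n) b)\<^sup>2))" by (intro sum_mono forms)
  also have "\<dots> = q * (\<Sum>n<N. \<Sum>b\<in>B. (inner (d n) b)\<^sup>2)"
    by (simp add: sum_distrib_left[symmetric]) (rule disjI2, rule sum.swap)
  also have "(\<Sum>n<N. \<Sum>b\<in>B. (inner (d n) b)\<^sup>2) = (\<Sum>n<N. (norm (d n))\<^sup>2)"
    using mem by (intro sum.cong) (auto simp: parseval)
  finally show ?thesis .
qed

section \<open>Projection onto a convex set in a pulled-back norm\<close>

lemma ex1_nearest_point:
  fixes T :: "'a::{real_inner, complete_space} \<Rightarrow> 'b::real_inner"
  assumes T: "bounded_linear T" and iso: "\<And>x. norm x \<le> norm (T x)"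
    and K: "closed K" "convex K" "K \<noteq> {}"
  shows "\<exists>!w. w \<in> K \<and> (\<forall>w'\<in>K. norm (T (u - w)) \<le> norm (T (u - w')))"
proof -
  interpret T: bounded_linear T by fact
  let ?f = "\<lambda>w. norm (T (u - w))"
  define d where "d = (INF w\<in>K. ?f w)"
  have bdd: "bdd_below (?f ` K)" by (rule bdd_belowI[of _ 0]) auto
  have dle: "d \<le> ?f w" if "w \<in> K" for w unfolding d_def by (rule cINF_lower[OF bdd that])
  have d0: "0 \<le> d" unfolding d_def by (rule cINF_greatest[OF K(3)]) auto
  \<comment> \<open>Parallelogram law for \<open>T (u - w)\<close> and \<open>T (u - w')\<close>:
    the midpoint lies in \<open>K\<close>, so its distance is at least \<open>d\<close>. This makes
    minimising sequences Cauchy and, at the end, gives the uniqueness that the \<open>THE\<close> in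
    \<open>proj_BV\<close> requires.\<close>
  have par: "(norm (T (w - w')))\<^sup>2 \<le> 2 * ((?f w)\<^sup>2 - d\<^sup>2) + 2 * ((?f w')\<^sup>2 - d\<^sup>2)" if "w \<in> K" "w' \<in> K" for w w'
  proof -
    let ?a = "T (u - w)" and ?b = "T (u - w')"
    have mid: "(1/2) *\<^sub>R w + (1/2) *\<^sub>R w' \<in> K" using convexD[OF K(2) that, of "1/2" "1/2"] by simp
    have uu: "(1/2) *\<^sub>R u + (1/2) *\<^sub>R u = u" by (simp flip: scaleR_left_distrib)
    have "(1/2) *\<^sub>R ((u - w) + (u - w')) = ((1/2) *\<^sub>R u + (1/2) *\<^sub>R u) - ((1/2) *\<^sub>R w + (1/2) *\<^sub>R w')"
      by (simp add: scaleR_add_right scaleR_diff_right)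
    then have "T (u - ((1/2) *\<^sub>R w + (1/2) *\<^sub>R w')) = (1/2) *\<^sub>R (?a + ?b)"
      by (metis uu T.add T.scaleR)
    then have "d \<le> norm (?a + ?b) / 2" using dle[OF mid] by simp
    then have "(2 * d)\<^sup>2 \<le> (norm (?a + ?b))\<^sup>2" using d0 by (intro power_mono) auto
    moreover have "T (w - w') = ?b - ?a" by (simp add: T.diff)
    moreover have "(norm (?b - ?a))\<^sup>2 + (norm (?a + ?b))\<^sup>2 = 2 * (norm ?a)\<^sup>2 + 2 * (norm ?b)\<^sup>2"
      by (simp add: norm_sq_diff norm_sq_add inner_commute)
    ultimately show ?thesis by (simp add: power2_eq_square)
  qed
  have "\<exists>w\<in>K. (?f w)\<^sup>2 < d\<^sup>2 + 1 / real (Suc n)" for n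
  proof -
    have "d < sqrt (d\<^sup>2 + 1 / real (Suc n))" using d0 by (intro real_less_rsqrt) auto
    then obtain w where "w \<in> K" "?f w < sqrt (d\<^sup>2 + 1 / real (Suc n))"
      using cINF_less_iff[OF K(3) bdd] unfolding d_def by metis
    then have "(?f w)\<^sup>2 < (sqrt (d\<^sup>2 + 1 / real (Suc n)))\<^sup>2" by (intro power_strict_mono) auto
    then show ?thesis using \<open>w \<in> K\<close> by (intro bexI[of _ w]) (auto simp: add_nonneg_nonneg)
  qed
  then obtain w where wK: "\<And>n. w n \<in> K" and wd: "\<And>n. (?f (w n))\<^sup>2 < d\<^sup>2 + 1 / real (Suc n)" by metis
  \<comment> \<open>\<open>T\<close> dominates the original norm, so completeness of the domain is
    enough.\<close>
  have "Cauchy w"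
  proof (rule metric_CauchyI)
    fix e :: real assume "e > 0"
    obtain n0 where n0: "1 / real (Suc n0) < e\<^sup>2 / 4"
      using \<open>e > 0\<close> by (metis nat_approx_posE zero_less_divide_iff zero_less_numeral zero_less_power)
    have "dist (w m) (w n) < e" if "m \<ge> n0" "n \<ge> n0" for m n
    proof -
      have h: "(?f (w i))\<^sup>2 - d\<^sup>2 < e\<^sup>2 / 4" if "i \<ge> n0" for i
      proof -
        have "(?f (w i))\<^sup>2 - d\<^sup>2 < 1 / real (Suc i)" using wd[of i] by (simp only: less_diff_eq diff_less_eq add.commute)
        also have "\<dots> \<le> 1 / real (Suc n0)" using that by (intro divide_left_mono) auto
        finally show ?thesis using n0 by (rule order.strict_trans)
      qed
      have "(norm (w m - w n))\<^sup>2 \<le> (norm (T (w m - w n)))\<^sup>2" by (intro power_mono iso) auto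
      also have "\<dots> < e\<^sup>2"
      proof -
        have "x \<le> 2 * y + 2 * z \<Longrightarrow> y < q / 4 \<Longrightarrow> z < q / 4 \<Longrightarrow> x < q" for x y z q :: real by linarith
        from this[OF par[OF wK wK] h[OF that(1)] h[OF that(2)]] show ?thesis .
      qed
      finally show ?thesis using \<open>e > 0\<close> by (auto simp: dist_norm intro: power2_less_imp_less)
    qed
    then show "\<exists>M. \<forall>m\<ge>M. \<forall>n\<ge>M. dist (w m) (w n) < e" by blast
  qed
  then obtain l where l: "w \<longlonglongrightarrow> l" using Cauchy_convergent convergent_def by blast
  have lK: "l \<in> K" using closed_sequentially[OF K(1)] wK l by auto
  have lim: "(\<lambda>n. (?f (w n))\<^sup>2) \<longlonglongrightarrow> (?f l)\<^sup>2" by (intro tendsto_intros T.tendsto l)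
  have "(\<lambda>n. d\<^sup>2 + 1 / real (Suc n)) \<longlonglongrightarrow> d\<^sup>2 + 0"
    by (intro tendsto_intros) (use LIMSEQ_inverse_real_of_nat in \<open>simp add: inverse_eq_divide\<close>)
  then have "(?f l)\<^sup>2 \<le> d\<^sup>2 + 0" by (rule LIMSEQ_le[OF lim]) (use wd less_imp_le in blast)
  then have fl: "?f l \<le> d" using d0 by (auto intro: power2_le_imp_le)
  show ?thesis
  proof (rule ex1I[of _ l])
    show "l \<in> K \<and> (\<forall>w'\<in>K. ?f l \<le> ?f w')" using lK fl dle by (meson order_trans)
    fix w' assume w': "w' \<in> K \<and> (\<forall>w''\<in>K. ?f w' \<le> ?f w'')"
    then have "?f w' \<le> d" using lK fl by (meson order_trans)
    then have "(?f w')\<^sup>2 \<le> d\<^sup>2" "(?f l)\<^sup>2 \<le> d\<^sup>2" using fl by (auto intro: power_mono)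
    moreover have "x \<le> 2 * (y - c) + 2 * (z - c) \<Longrightarrow> y \<le> c \<Longrightarrow> z \<le> c \<Longrightarrow> x \<le> 0" for x y z c :: real
      by (smt (verit) mult_less_0_iff)
    ultimately have "(norm (T (w' - l)))\<^sup>2 \<le> 0" using par[of w' l] w' lK by blast
    then have "norm (w' - l) \<le> 0" using iso[of "w' - l"] by simp
    then show "w' = l" by simp
  qed
qed

text \<open>First-order optimality: a small move from \<open>w\<close> towards \<open>x\<close>
  stays in \<open>K\<close> and would decrease the distance if the inner product were
  positive.\<close>

lemma nearest_point_variational:
  fixes T :: "'a::real_inner \<Rightarrow> 'b::real_inner"
  assumes T: "linear T" and K: "convex K" and w: "w \<in> K" "\<And>w'. w' \<in> K \<Longrightarrow> norm (T (u - w)) \<le> norm (T (u - w'))"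
    and x: "x \<in> K"
  shows "inner (T (u - w)) (T (x - w)) \<le> 0"
proof (rule ccontr)
  assume neg: "\<not> ?thesis"
  let ?i = "inner (T (u - w)) (T (x - w))" and ?n = "(norm (T (x - w)))\<^sup>2"
  \<comment> \<open>Small enough that the quadratic cost \<open>t * ?n\<close> stays below the
    linear gain \<open>?i\<close>; the \<open>+ 1\<close> also covers \<open>?n = 0\<close>.\<close>
  define t where "t = min 1 (?i / (?n + 1))"
  have n0: "?n + 1 > 0" by (simp add: add_nonneg_pos)
  have t: "0 < t" "t \<le> 1" "t * (?n + 1) \<le> ?i"
  proof -
    show "0 < t" "t \<le> 1" using neg n0 by (auto simp: t_def)
    have "t \<le> ?i / (?n + 1)" by (simp add: t_def)
    then show "t * (?n + 1) \<le> ?i" by (simp add: pos_le_divide_eq[OF n0])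
  qed
  have "w + t *\<^sub>R (x - w) \<in> K" using convexD_alt[OF K w(1) x, of t] t by (simp add: algebra_simps)
  then have "norm (T (u - w)) \<le> norm (T (u - (w + t *\<^sub>R (x - w))))" by (rule w(2))
  also have "T (u - (w + t *\<^sub>R (x - w))) = T (u - w) - t *\<^sub>R T (x - w)"
    by (simp only: diff_diff_eq[symmetric] linear_diff[OF T, of "u - w"] linear_scale[OF T])
  finally have "(norm (T (u - w)))\<^sup>2 \<le> (norm (T (u - w) - t *\<^sub>R T (x - w)))\<^sup>2" by (intro power_mono) auto
  also have "\<dots> = (norm (T (u - w)))\<^sup>2 - 2 * t * ?i + t\<^sup>2 * ?n"
    by (simp add: norm_sq_diff power_mult_distrib)
  finally have "t * (2 * ?i) \<le> t * (t * ?n)" by (simp add: power2_eq_square algebra_simps)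
  then have "2 * ?i \<le> t * ?n" using t(1) by simp
  then show False using t neg by (simp add: algebra_simps)
qed

text \<open>Add the variational inequalities at \<open>w\<close> against \<open>z\<close> and at
  \<open>z\<close> against \<open>w\<close>; Cauchy-Schwarz and cancelling one factor
  \<open>norm (T (w - z))\<close> finish.\<close>

lemma nearest_point_nonexpansive:
  fixes T :: "'a::real_inner \<Rightarrow> 'b::real_inner"
  assumes T: "linear T" and K: "convex K"
    and w: "w \<in> K" "\<And>w'. w' \<in> K \<Longrightarrow> norm (T (u - w)) \<le> norm (T (u - w'))"
    and z: "z \<in> K" "\<And>w'. w' \<in> K \<Longrightarrow> norm (T (v - z)) \<le> norm (T (v - w'))"
  shows "norm (T (w - z)) \<le> norm (T (u - v))"
proof -
  have "inner (T (u - w)) (T (z - w)) \<le> 0" by (rule nearest_point_variational[OF T K w z(1)])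
  moreover have "inner (T (v - z)) (T (w - z)) \<le> 0" by (rule nearest_point_variational[OF T K z w(1)])
  ultimately have "inner (T (w - z)) (T (w - z)) \<le> inner (T (w - z)) (T (u - v))"
    by (simp add: linear_diff[OF T] inner_diff inner_commute algebra_simps)
  also have "\<dots> \<le> norm (T (w - z)) * norm (T (u - v))" by (rule norm_cauchy_schwarz)
  finally have "norm (T (w - z)) * norm (T (w - z)) \<le> norm (T (w - z)) * norm (T (u - v))"
    by (simp add: dot_square_norm power2_eq_square)
  then show ?thesis by (cases "norm (T (w - z)) = 0") auto
qed

section \<open>The Kalman update\<close>

locale weighted_observation =
  fixes H :: "'h::{real_inner, complete_space} \<Rightarrow> real^'k" and Hadj :: "real^'k \<Rightarrow> 'h" and \<beta> :: real
  assumes H_lin: "bounded_linear H"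
    and adj: "inner (H u) z = inner u (Hadj z)"
    and HHadj: "H (Hadj z) = z"
    and beta: "\<beta> \<ge> 0"
begin

definition Q :: "'h \<Rightarrow> 'h" where "Q x = x - Hadj (H x)"

definition T :: "'h \<Rightarrow> 'h \<times> 'h" where "T x = (x, sqrt \<beta> *\<^sub>R Hadj (H x))"

sublocale H: bounded_linear H by (rule H_lin)

lemma adj': "inner (Hadj z) u = inner z (H u)"
  by (metis adj inner_commute)

lemma norm_Hadj: "norm (Hadj z) = norm z"
  by (simp add: norm_eq_sqrt_inner adj' HHadj)

text \<open>The adjoint is given only as a function satisfying the adjunction; testing its defects
  against all \<open>u\<close> makes it linear, and \<open>H (Hadj z) = z\<close> makes it an
  isometry.\<close>

sublocale Hadj: bounded_linear Hadj
proof (rule bounded_linear_intro[where K = 1])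
  show "Hadj (x + y) = Hadj x + Hadj y" for x y
  proof -
    have "inner u (Hadj (x + y) - (Hadj x + Hadj y)) = 0" for u
      by (simp add: inner_diff_right inner_add_right adj[symmetric])
    then show ?thesis by (metis inner_eq_zero_iff right_minus_eq)
  qed
  show "Hadj (c *\<^sub>R x) = c *\<^sub>R Hadj x" for c x
  proof -
    have "inner u (Hadj (c *\<^sub>R x) - c *\<^sub>R Hadj x) = 0" for u
      by (simp add: inner_diff_right adj[symmetric])
    then show ?thesis by (metis inner_eq_zero_iff right_minus_eq)
  qed
qed (simp add: norm_Hadj)

lemma bounded_linear_Q: "bounded_linear Q"
  unfolding Q_def by (intro bounded_linear_sub bounded_linear_ident bounded_linear_compose[OF Hadj.bounded_linear_axioms] H_lin)

sublocale Q: bounded_linear Q by (rule bounded_linear_Q)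

lemma bounded_linear_T: "bounded_linear T"
  unfolding T_def
  by (intro bounded_linear_Pair bounded_linear_ident bounded_linear_compose[OF bounded_linear_scaleR_right]
      bounded_linear_compose[OF Hadj.bounded_linear_axioms] H_lin)

sublocale T: bounded_linear T by (rule bounded_linear_T)

lemma H_Q: "H (Q x) = 0"
  by (simp add: Q_def H.diff HHadj)

lemma Q_Hadj: "Q (Hadj z) = 0"
  by (simp add: Q_def HHadj)

lemma Q_self_adjoint: "inner (Q x) y = inner x (Q y)"
  by (simp only: Q_def inner_diff adj' adj[symmetric])

lemma norm_sq_Q_H: "(norm x)\<^sup>2 = (norm (Q x))\<^sup>2 + (norm (H x))\<^sup>2"
  by (simp add: power2_norm_eq_inner Q_def inner_diff adj adj' HHadj)

lemma norm_Q_le: "norm (Q x) \<le> norm x"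
  by (rule power2_le_imp_le) (use norm_sq_Q_H[of x] in auto)

lemma norm_H_le: "norm (H x) \<le> norm x"
  by (rule power2_le_imp_le) (use norm_sq_Q_H[of x] in auto)

lemma norm_T_sq: "(norm (T x))\<^sup>2 = (norm x)\<^sup>2 + \<beta> * (norm (H x))\<^sup>2"
  using beta by (simp add: T_def norm_Pair norm_Hadj power_mult_distrib add_nonneg_nonneg)

lemma Vnorm_eq: "Vnorm \<beta> (Hadj \<circ> H) x = norm (T x)"
  by (simp add: Vnorm_def norm_Hadj flip: norm_T_sq)

text \<open>In these orthogonal coordinates the extra weight falls on the observed part alone. The
  factors \<open>1 + \<beta>\<close> and \<open>sqrt (1 + \<beta>)\<close> below originate
  here.\<close>

lemma norm_T_sq_Q_H: "(norm (T x))\<^sup>2 = (norm (Q x))\<^sup>2 + (1 + \<beta>) * (norm (H x))\<^sup>2"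
  by (simp add: norm_T_sq norm_sq_Q_H[of x] algebra_simps)

text \<open>The weight sees nothing of an unobserved vector, so the squeezing hypothesis becomes a
  bound on the plain norm of \<open>Q\<close>.\<close>

lemma norm_T_Q: "norm (T (Q x)) = norm (Q x)"
  by (rule power2_eq_imp_eq) (simp_all add: norm_T_sq H_Q)

lemma norm_le_T: "norm x \<le> norm (T x)"
  by (rule power2_le_imp_le) (use beta in \<open>simp_all add: norm_T_sq\<close>)

lemma norm_H_le_T: "norm (H x) \<le> norm (T x)"
  using norm_H_le norm_le_T by (rule order_trans)

lemma norm_T_le: "norm (T x) \<le> norm (Q x) + sqrt (1 + \<beta>) * norm (H x)"
proof (rule power2_le_imp_le)
  show "(norm (T x))\<^sup>2 \<le> (norm (Q x) + sqrt (1 + \<beta>) * norm (H x))\<^sup>2"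
    using beta by (simp add: norm_T_sq_Q_H power2_sum power_mult_distrib)
qed (use beta in auto)

context
  fixes r :: real
  assumes r: "r \<ge> 0"
begin

lemma proj_BV_nearest:
  "norm (proj_BV r \<beta> (Hadj \<circ> H) u) \<le> r"
  "norm w \<le> r \<Longrightarrow> norm (T (u - proj_BV r \<beta> (Hadj \<circ> H) u)) \<le> norm (T (u - w))"
proof -
  have "\<exists>!w. w \<in> cball 0 r \<and> (\<forall>w'\<in>cball 0 r. norm (T (u - w)) \<le> norm (T (u - w')))"
    using r by (intro ex1_nearest_point bounded_linear_T norm_le_T) auto
  from theI'[OF this]
  have "proj_BV r \<beta> (Hadj \<circ> H) u \<in> cball 0 r \<and>
      (\<forall>w'\<in>cball 0 r. norm (T (u - proj_BV r \<beta> (Hadj \<circ> H) u)) \<le> norm (T (u - w')))"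
    by (simp add: proj_BV_def Vnorm_eq)
  then show "norm (proj_BV r \<beta> (Hadj \<circ> H) u) \<le> r"
    "norm w \<le> r \<Longrightarrow> norm (T (u - proj_BV r \<beta> (Hadj \<circ> H) u)) \<le> norm (T (u - w))" by auto
qed

lemma proj_BV_nonexpansive:
  "norm (T (proj_BV r \<beta> (Hadj \<circ> H) u - proj_BV r \<beta> (Hadj \<circ> H) v)) \<le> norm (T (u - v))"
  by (rule nearest_point_nonexpansive[where K = "cball 0 r"])
     (auto simp: proj_BV_nearest T.linear_axioms)

lemma proj_BV_ident:
  assumes "norm u \<le> r" shows "proj_BV r \<beta> (Hadj \<circ> H) u = u"
proof -
  have "norm (T (u - proj_BV r \<beta> (Hadj \<circ> H) u)) \<le> norm (T (u - u))" by (rule proj_BV_nearest(2)[OF assms])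
  then have "norm (T (u - proj_BV r \<beta> (Hadj \<circ> H) u)) \<le> 0" by (simp add: T.zero)
  then have "norm (u - proj_BV r \<beta> (Hadj \<circ> H) u) \<le> 0"
    by (rule order_trans[OF norm_le_T])
  then show ?thesis by simp
qed

end

end

section \<open>One analysis step with prescribed forecast deviations\<close>

locale kalman_analysis = weighted_observation H Hadj \<beta>
  for H :: "'h::{real_inner, complete_space} \<Rightarrow> real^'k" and Hadj :: "real^'k \<Rightarrow> 'h" and \<beta> :: real +
  fixes R :: "real^'k^'k" and \<epsilon> \<rho> b :: real and N :: nat and d :: "nat \<Rightarrow> 'h" and \<Sigma> :: "'h \<Rightarrow> 'h"
  assumes rho: "\<rho> > 0" "\<And>x. \<rho> * (norm x)\<^sup>2 \<le> inner (R *v x) x"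
    and R_norm: "\<And>x. norm (R *v x) \<le> b * norm x"
    and R_sym: "\<And>x y. inner (R *v x) y = inner x (R *v y)"
    and eps: "\<epsilon> > 0"
    and N: "N \<ge> 2"
    and Sigma: "\<And>x. \<Sigma> x = (1 / real N) *\<^sub>R (\<Sum>n<N. inner (d n) x *\<^sub>R d n)"
begin

text \<open>\<open>G\<close> is the forecast covariance seen through the observation and
  \<open>S\<close> the innovation covariance, both as operators on the observation space instead of
  matrices.\<close>

definition G :: "real^'k \<Rightarrow> real^'k" where "G c = H (\<Sigma> (Hadj c))"

definition S :: "real^'k \<Rightarrow> real^'k" where "S c = G c + \<epsilon>\<^sup>2 *\<^sub>R (R *v c)"

lemma Sigma_sym: "inner (\<Sigma> x) y = inner x (\<Sigma> y)"
  by (simp add: Sigma inner_sum_left inner_sum_right) (simp add: inner_commute mult.commute)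

lemma Sigma_form: "inner (\<Sigma> x) x = (1 / real N) * (\<Sum>n<N. (inner (d n) x)\<^sup>2)"
  by (simp add: Sigma inner_sum_left power2_eq_square)

lemma Sigma_linear: "linear \<Sigma>"
proof
  show "\<Sigma> (x + y) = \<Sigma> x + \<Sigma> y" for x y
    by (simp add: Sigma inner_add_right scaleR_add_left sum.distrib scaleR_add_right)
  show "\<Sigma> (c *\<^sub>R x) = c *\<^sub>R \<Sigma> x" for c x
    by (simp add: Sigma scaleR_sum_right mult.left_commute mult.assoc)
qed

lemma G_linear: "linear G"
proof -
  have "linear (H \<circ> (\<Sigma> \<circ> Hadj))"
    by (intro linear_compose Sigma_linear H.linear_axioms Hadj.linear_axioms)
  then show ?thesis by (simp add: comp_def G_def[abs_def])
qed

lemma S_linear: "linear S"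
  unfolding S_def[abs_def]
  by (intro linear_compose_add G_linear linear_compose_scale_right) (rule matrix_vector_mul_linear)

lemma G_sym: "inner (G x) y = inner x (G y)"
  by (simp add: G_def adj Sigma_sym) (simp add: adj' inner_commute)

lemma G_form: "inner (G c) c = (1 / real N) * (\<Sum>n<N. (inner (H (d n)) c)\<^sup>2)"
  by (simp add: G_def adj Sigma_form)

lemma G_nonneg: "inner (G c) c \<ge> 0"
  by (simp add: G_form sum_nonneg)

lemma R_nonneg: "inner (R *v c) c \<ge> 0"
  using rho(1) rho(2)[of c] by (meson less_imp_le mult_nonneg_nonneg order_trans zero_le_power2)

lemma S_form: "inner (S c) c = inner (G c) c + \<epsilon>\<^sup>2 * inner (R *v c) c"
  by (simp add: S_def inner_add_left)

lemma S_lower: "\<epsilon>\<^sup>2 * \<rho> * (norm c)\<^sup>2 \<le> inner (S c) c"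
proof -
  have "\<epsilon>\<^sup>2 * (\<rho> * (norm c)\<^sup>2) \<le> \<epsilon>\<^sup>2 * inner (R *v c) c" by (intro mult_left_mono rho) auto
  then show ?thesis using G_nonneg[of c] by (simp add: S_form mult.assoc)
qed

lemma S_eq_0: "S c = 0 \<Longrightarrow> c = 0"
proof -
  assume "S c = 0"
  then have "\<epsilon>\<^sup>2 * \<rho> * (norm c)\<^sup>2 \<le> 0" using S_lower[of c] by simp
  then show "c = 0" using eps rho(1) by (simp add: mult_le_0_iff)
qed

text \<open>From here on the gain is used only through a solution \<open>c\<close> of
  \<open>S c = y\<close>. Coercivity makes \<open>S\<close> injective, hence invertible in finite
  dimension, so \<open>matrix_inv\<close> is a genuine inverse.\<close>

lemma kalman_gain_solve: "\<exists>c. kalman_gain H Hadj R \<epsilon> \<Sigma> y = \<Sigma> (Hadj c) \<and> S c = y"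
proof -
  let ?S = "(\<chi> i j. (H (\<Sigma> (Hadj (axis j 1)))) $ i) + (\<epsilon>^2) *\<^sub>R R"
  have M: "(\<chi> i j. (H (\<Sigma> (Hadj (axis j 1)))) $ i) = matrix G"
    by (simp add: matrix_def G_def)
  have "matrix G *v x = G x" for x
    by (rule matrix_works) (simp add: linear_matrix_vector_mul_eq G_linear)
  then have mul: "?S *v x = S x" for x
    by (simp add: M matrix_vector_mult_add_rdistrib S_def scaleR_matrix_vector_assoc[symmetric])
  have "inj ((*v) ?S)"
  proof (rule injI)
    fix x y assume "?S *v x = ?S *v y"
    then have "S (x - y) = 0" by (simp add: mul linear_diff[OF S_linear])
    then show "x = y" using S_eq_0 by fastforce
  qed
  then have "invertible ?S" by (simp add: invertible_left_inverse matrix_left_invertible_injective)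
  then have inv: "?S ** matrix_inv ?S = mat 1"
    unfolding invertible_def matrix_inv_def using someI_ex[of "\<lambda>A'. ?S ** A' = mat 1 \<and> A' ** ?S = mat 1"] by blast
  have "S (matrix_inv ?S *v y) = y"
    using mul[of "matrix_inv ?S *v y"] by (simp add: matrix_vector_mul_assoc inv)
  then show ?thesis unfolding kalman_gain_def Let_def by blast
qed

text \<open>Measuring the correction by the energy \<open>inner (S c) c\<close> instead of
  \<open>norm c\<close> lets the coercivity constant enter as \<open>1 / sqrt \<kappa>\<close>,
  which asks for a weaker inverse moment than \<open>1 / \<kappa>\<close>.\<close>

lemma solve_bound:
  assumes c: "S c = y" and k: "\<kappa> > 0" "\<And>x. \<kappa> * (norm x)\<^sup>2 \<le> inner (S x) x"
  shows "inner (S c) c \<le> (norm y / sqrt \<kappa>)\<^sup>2"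
proof -
  have *: "inner (S c) c \<le> norm y * norm c" using norm_cauchy_schwarz[of y c] c by simp
  then have "norm c * (\<kappa> * norm c) \<le> norm c * norm y" using k(2)[of c] by (simp add: power2_eq_square ac_simps)
  then have "\<kappa> * norm c \<le> norm y" by (cases "norm c = 0") auto
  then have "norm c \<le> norm y / \<kappa>" using k(1) by (simp add: field_simps)
  then have "norm y * norm c \<le> norm y * (norm y / \<kappa>)" by (intro mult_left_mono) auto
  with * show ?thesis using k(1) by (simp add: power_divide power2_eq_square)
qed

text \<open>The unobserved part of the correction is a cross covariance, of size \<open>s\<close>
  times the root of the energy; in the observed part the forecast error cancels and only terms of
  order \<open>\<epsilon>\<close> remain. So an innovation of order one costs order
  \<open>\<epsilon>\<close> once \<open>s\<close> has that order and \<open>\<kappa>\<close> is of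
  order one.\<close>

lemma analysis_error:
  assumes m: "m = \<mu> + kalman_gain H Hadj R \<epsilon> \<Sigma> y"
    and y: "y + H (\<mu> - u) = \<epsilon> *\<^sub>R \<eta>"
    and k: "\<kappa> > 0" "\<And>x. \<kappa> * (norm x)\<^sup>2 \<le> inner (S x) x"
    and s: "s \<ge> 0" "(1 / real N) * (\<Sum>n<N. (norm (Q (d n)))\<^sup>2) \<le> s\<^sup>2"
  shows "norm (T (m - u)) \<le> norm (Q (\<mu> - u)) + sqrt (1 + \<beta>) * (\<epsilon> * norm \<eta>)
     + (s + sqrt (1 + \<beta>) * (\<epsilon> * (b / sqrt \<rho>))) * (norm y / sqrt \<kappa>)"
proof -
  have b: "b \<ge> 0"
    using order_trans[OF norm_ge_zero R_norm, of "axis undefined 1"] by (simp add: norm_axis_1)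
  obtain c where c: "kalman_gain H Hadj R \<epsilon> \<Sigma> y = \<Sigma> (Hadj c)" "S c = y" using kalman_gain_solve by blast
  define q where "q = sqrt (inner (S c) c)"
  have S0: "inner (S c) c \<ge> 0" using S_lower[of c] eps rho(1) by (meson less_imp_le mult_nonneg_nonneg order_trans zero_le_power2)
  have q0: "q \<ge> 0" using S0 by (simp add: q_def)
  have qle: "q \<le> norm y / sqrt \<kappa>"
    unfolding q_def using solve_bound[OF c(2) k] k(1) by (intro real_le_lsqrt) auto
  \<comment> \<open>Cauchy-Schwarz over the particles separates observed from unobserved
    deviations.\<close>
  have QK: "norm (Q (\<Sigma> (Hadj c))) \<le> s * q"
  proof -
    have N0: "real N > 0" using N by simp
    have "norm (Q (\<Sigma> (Hadj c))) = (1 / real N) * norm (\<Sum>n<N. inner (H (d n)) c *\<^sub>R Q (d n))"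
      by (simp add: Sigma Q.scaleR Q.sum adj)
    also have "\<dots> \<le> (1 / real N) * (\<Sum>n<N. \<bar>inner (H (d n)) c\<bar> * norm (Q (d n)))"
      by (intro mult_left_mono order_trans[OF norm_sum]) auto
    also have "\<dots> \<le> (1 / real N) * (sqrt (\<Sum>n<N. (inner (H (d n)) c)\<^sup>2) * sqrt (\<Sum>n<N. (norm (Q (d n)))\<^sup>2))"
      using L2_set_mult_ineq[of "\<lambda>n. inner (H (d n)) c" "\<lambda>n. norm (Q (d n))" "{..<N}"]
      by (intro mult_left_mono) (auto simp: L2_set_def)
    also have "\<dots> = sqrt (inner (G c) c) * sqrt ((1 / real N) * (\<Sum>n<N. (norm (Q (d n)))\<^sup>2))"
      by (simp add: G_form real_sqrt_mult real_sqrt_divide flip: real_sqrt_mult)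
    also have "\<dots> \<le> q * s"
    proof (intro mult_mono)
      show "sqrt (inner (G c) c) \<le> q" unfolding q_def using R_nonneg[of c] by (simp add: S_form)
      show "sqrt ((1 / real N) * (\<Sum>n<N. (norm (Q (d n)))\<^sup>2)) \<le> s" using s by (intro real_le_lsqrt) auto
    qed (auto simp: q0 sum_nonneg)
    finally show ?thesis by (simp add: mult.commute)
  qed
  have QQ: "norm (Q (m - u)) \<le> norm (Q (\<mu> - u)) + s * q"
  proof -
    have "Q (m - u) = Q (\<mu> - u) + Q (\<Sigma> (Hadj c))"
      by (simp add: m c(1) Q.add Q.diff)
    then show ?thesis using norm_triangle_ineq[of "Q (\<mu> - u)" "Q (\<Sigma> (Hadj c))"] QK by simp
  qed
  have HH: "norm (H (m - u)) \<le> \<epsilon> * norm \<eta> + \<epsilon> * (b / sqrt \<rho>) * q"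
  proof -
    \<comment> \<open>Replacing \<open>G c\<close> by
      \<open>y - \<epsilon>\<^sup>2 *\<^sub>R (R *v c)\<close> cancels the forecast error
      \<open>H (\<mu> - u)\<close>.\<close>
    have "H (m - u) = H (\<mu> - u) + G c" by (simp add: m c(1) H.add H.diff G_def)
    also have "\<dots> = \<epsilon> *\<^sub>R \<eta> - \<epsilon>\<^sup>2 *\<^sub>R (R *v c)"
      using y c(2) by (simp add: S_def algebra_simps)
    finally have "norm (H (m - u)) \<le> norm (\<epsilon> *\<^sub>R \<eta>) + norm (\<epsilon>\<^sup>2 *\<^sub>R (R *v c))" by (metis norm_triangle_ineq4)
    moreover have "norm (\<epsilon>\<^sup>2 *\<^sub>R (R *v c)) \<le> \<epsilon> * (b / sqrt \<rho>) * q"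
    proof -
      have "\<epsilon> * sqrt \<rho> * norm c \<le> q"
        unfolding q_def using S_lower[of c] by (intro real_le_rsqrt) (use rho(1) in \<open>simp add: power_mult_distrib\<close>)
      then have "norm c \<le> q / (\<epsilon> * sqrt \<rho>)" using eps rho(1) by (simp add: field_simps)
      then have "\<epsilon>\<^sup>2 * (b * norm c) \<le> \<epsilon>\<^sup>2 * (b * (q / (\<epsilon> * sqrt \<rho>)))" using b by (intro mult_left_mono) auto
      moreover have "\<epsilon>\<^sup>2 * norm (R *v c) \<le> \<epsilon>\<^sup>2 * (b * norm c)" by (intro mult_left_mono R_norm) auto
      moreover have "\<epsilon>\<^sup>2 * (b * (q / (\<epsilon> * sqrt \<rho>))) = \<epsilon> * (b / sqrt \<rho>) * q"
        using eps by (simp add: power2_eq_square field_simps)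
      ultimately show ?thesis by simp
    qed
    ultimately show ?thesis using eps by simp
  qed
  have "norm (T (m - u)) \<le> norm (Q (m - u)) + sqrt (1 + \<beta>) * norm (H (m - u))" by (rule norm_T_le)
  also have "\<dots> \<le> (norm (Q (\<mu> - u)) + s * q) + sqrt (1 + \<beta>) * (\<epsilon> * norm \<eta> + \<epsilon> * (b / sqrt \<rho>) * q)"
    using beta by (intro add_mono mult_left_mono QQ HH) auto
  also have "\<dots> = norm (Q (\<mu> - u)) + sqrt (1 + \<beta>) * (\<epsilon> * norm \<eta>) + (s + sqrt (1 + \<beta>) * (\<epsilon> * (b / sqrt \<rho>))) * q"
    by (simp add: algebra_simps)
  also have "\<dots> \<le> norm (Q (\<mu> - u)) + sqrt (1 + \<beta>) * (\<epsilon> * norm \<eta>) + (s + sqrt (1 + \<beta>) * (\<epsilon> * (b / sqrt \<rho>))) * (norm y / sqrt \<kappa>)"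
    using s(1) beta eps b rho(1) by (intro add_left_mono mult_left_mono qle) auto
  finally show ?thesis .
qed

text \<open>The update subtracts a nonnegative form, so the unobserved trace cannot grow. On the
  observed part the posterior form is at most \<open>\<epsilon>\<^sup>2 R\<close>: an observation
  leaves no more uncertainty than its own noise. Summing over the axes yields the trace of
  \<open>R\<close>.\<close>

lemma analysis_covariance:
  assumes cov: "\<And>x. (1 / real (N - 1)) *\<^sub>R outer_sum N U m x = \<Sigma> x - kalman_gain H Hadj R \<epsilon> \<Sigma> (H (\<Sigma> x))"
  shows "(1 / real (N - 1)) * (\<Sum>n<N. (norm (Q (U n - m)))\<^sup>2) \<le> (1 / real N) * (\<Sum>n<N. (norm (Q (d n)))\<^sup>2)" (is ?A)
    and "(1 / real (N - 1)) * (\<Sum>n<N. (norm (H (U n - m)))\<^sup>2) \<le> \<epsilon>\<^sup>2 * (\<Sum>i\<in>UNIV. R $ i $ i)" (is ?B)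
proof -
  have N1: "real (N - 1) > 0" using N by simp
  have form: "\<exists>c. (1 / real (N - 1)) * (\<Sum>n<N. (inner (U n - m) x)\<^sup>2) = inner (\<Sigma> x) x - inner c (H (\<Sigma> x)) \<and> S c = H (\<Sigma> x)" for x
  proof -
    obtain c where c: "kalman_gain H Hadj R \<epsilon> \<Sigma> (H (\<Sigma> x)) = \<Sigma> (Hadj c)" "S c = H (\<Sigma> x)"
      using kalman_gain_solve by blast
    have "(1 / real (N - 1)) * (\<Sum>n<N. (inner (U n - m) x)\<^sup>2) = inner ((1 / real (N - 1)) *\<^sub>R outer_sum N U m x) x"
      by (simp add: outer_sum_def inner_sum_left power2_eq_square)
    also have "\<dots> = inner (\<Sigma> x) x - inner (\<Sigma> (Hadj c)) x" by (simp only: cov c(1) inner_diff_left)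
    also have "inner (\<Sigma> (Hadj c)) x = inner c (H (\<Sigma> x))" by (simp add: Sigma_sym adj')
    finally show ?thesis using c(2) by blast
  qed
  have le: "(1 / real (N - 1)) * (\<Sum>n<N. (inner (U n - m) x)\<^sup>2) \<le> (1 / real N) * (\<Sum>n<N. (inner (d n) x)\<^sup>2)" for x
  proof -
    obtain c where c: "(1 / real (N - 1)) * (\<Sum>n<N. (inner (U n - m) x)\<^sup>2) = inner (\<Sigma> x) x - inner c (H (\<Sigma> x))" "S c = H (\<Sigma> x)"
      using form by blast
    have "0 \<le> \<epsilon>\<^sup>2 * \<rho> * (norm c)\<^sup>2" using rho(1) by simp
    also have "\<dots> \<le> inner c (H (\<Sigma> x))" using S_lower[of c] c(2) by (simp add: inner_commute)
    finally show ?thesis using c(1) by (simp add: Sigma_form)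
  qed
  show ?A
  proof -
    have "(\<Sum>n<N. (norm (Q (U n - m)))\<^sup>2) \<le> (real (N - 1) / real N) * (\<Sum>n<N. (norm (Q (d n)))\<^sup>2)"
    proof (rule sum_norm_sq_le_of_forms)
      show "(\<Sum>n<N. (inner (Q (U n - m)) x)\<^sup>2) \<le> (real (N - 1) / real N) * (\<Sum>n<N. (inner (Q (d n)) x)\<^sup>2)" for x
        using le[of "Q x"] N1 by (simp add: Q_self_adjoint field_simps)
    qed simp
    then show ?thesis using N1 by (simp add: field_simps)
  qed
  show ?B
  proof -
    have e: "(1 / real (N - 1)) * (\<Sum>n<N. (inner (U n - m) (Hadj e))\<^sup>2) \<le> \<epsilon>\<^sup>2 * inner (R *v e) e" for e
    proof -
      obtain c where c: "(1 / real (N - 1)) * (\<Sum>n<N. (inner (U n - m) (Hadj e))\<^sup>2) = inner (\<Sigma> (Hadj e)) (Hadj e) - inner c (G e)" "S c = G e"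
        using form[of "Hadj e"] by (auto simp: G_def)
      \<comment> \<open>With this \<open>h\<close> the equation for \<open>c\<close> reads
        \<open>G h = \<epsilon>\<^sup>2 *\<^sub>R (R *v c)\<close>. The posterior form is
        \<open>inner (G h) h + inner (G h) c\<close>; adding the nonnegative
        \<open>inner (G h) h\<close> and \<open>\<epsilon>\<^sup>2 * inner (R *v h) h\<close>
        completes the square to \<open>\<epsilon>\<^sup>2 * inner (R *v e) e\<close>.\<close>
      define h where "h = e - c"
      have e: "e = c + h" by (simp add: h_def)
      have Gh: "G h = \<epsilon>\<^sup>2 *\<^sub>R (R *v c)"
        unfolding h_def linear_diff[OF G_linear] c(2)[symmetric] by (simp add: S_def)
      have Ge: "inner (\<Sigma> (Hadj e)) (Hadj e) = inner (G e) e" by (simp add: G_def adj)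
      have "inner (G e) e - inner c (G e) = inner h (G e)" by (simp add: h_def inner_diff_left inner_commute)
      also have "\<dots> = inner (G h) h + inner (G h) c"
      proof -
        have "inner h (G c) = inner (G h) c" by (rule G_sym[symmetric])
        moreover have "inner h (G h) = inner (G h) h" by (rule inner_commute)
        ultimately show ?thesis by (simp only: e linear_add[OF G_linear] inner_add_right)
      qed
      also have "\<dots> \<le> 2 * inner (G h) h + inner (G h) c + \<epsilon>\<^sup>2 * inner (R *v h) h"
        using G_nonneg[of h] R_nonneg[of h] by simp
      also have "\<dots> = \<epsilon>\<^sup>2 * inner (R *v e) e"
      proof -
        have "inner (R *v h) c = inner (R *v c) h" unfolding R_sym[of h c] by (rule inner_commute)
        then show ?thesis
          by (simp add: Gh e matrix_vector_right_distrib inner_add algebra_simps)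
      qed
      finally show ?thesis using c(1) Ge by simp
    qed
    have "(norm (H (U n - m)))\<^sup>2 = (\<Sum>i\<in>UNIV. (inner (U n - m) (Hadj (axis i 1)))\<^sup>2)" for n
    proof -
      have "(norm (H (U n - m)))\<^sup>2 = (\<Sum>i\<in>UNIV. (H (U n - m) $ i)\<^sup>2)"
        unfolding power2_norm_eq_inner inner_vec_def by (simp add: power2_eq_square)
      also have "\<dots> = (\<Sum>i\<in>UNIV. (inner (H (U n - m)) (axis i 1))\<^sup>2)" by (simp add: inner_axis)
      finally show ?thesis by (simp add: adj)
    qed
    then have "(1 / real (N - 1)) * (\<Sum>n<N. (norm (H (U n - m)))\<^sup>2)
      = (\<Sum>i\<in>UNIV. (1 / real (N - 1)) * (\<Sum>n<N. (inner (U n - m) (Hadj (axis i 1)))\<^sup>2))"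
      by (simp only: sum_distrib_left[symmetric] sum.swap[of _ "{..<N}"])
    also have "\<dots> \<le> (\<Sum>i\<in>UNIV. \<epsilon>\<^sup>2 * inner (R *v axis i 1) (axis i 1))" by (intro sum_mono e)
    also have "\<dots> = \<epsilon>\<^sup>2 * (\<Sum>i\<in>UNIV. R $ i $ i)"
      by (simp add: sum_distrib_left inner_axis matrix_vector_mult_basis column_def)
    finally show ?thesis .
  qed
qed

end

section \<open>Negative moments of Gaussian Gram matrices\<close>

text \<open>The distance from row \<open>i\<close> to the span of the other rows, written over
  coefficient vectors normalised at \<open>i\<close>.\<close>

definition row_gap :: "real^'n^'n \<Rightarrow> 'n \<Rightarrow> real" where
  "row_gap A i = (INF x\<in>{x. x $ i = 1}. norm (x v* A))"

lemma coord_one_nonempty: "{x :: real^'n. x $ i = 1} \<noteq> {}"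
  by (auto intro!: exI[of _ "axis i 1"])

lemma row_gap_bdd: "bdd_below ((\<lambda>x. norm (x v* A)) ` {x :: real^'n. x $ i = 1})"
  by (rule bdd_belowI[of _ 0]) auto

lemma row_gap_mult_le: "\<bar>x $ i\<bar> * row_gap A i \<le> norm (x v* A)"
proof (cases "x $ i = 0")
  case False
  have "row_gap A i \<le> norm (((1 / x $ i) *\<^sub>R x) v* A)"
    unfolding row_gap_def by (rule cINF_lower[OF row_gap_bdd]) (use False in auto)
  also have "((1 / x $ i) *\<^sub>R x) v* A = (1 / x $ i) *\<^sub>R (x v* A)"
    by (simp add: scaleR_vector_matrix_assoc)
  finally have "row_gap A i \<le> norm (x v* A) / \<bar>x $ i\<bar>" by simp
  then show ?thesis using False by (simp add: pos_le_divide_eq mult.commute)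
qed simp

text \<open>Sublevel sets are unions, uncountable in general, of open sets: upper semicontinuity
  gives measurability.\<close>

lemma borel_measurable_row_gap [measurable]: "(\<lambda>A :: real^'n^'n. row_gap A i) \<in> borel_measurable borel"
proof (rule borel_measurableI_less)
  fix t :: real
  have "{A :: real^'n^'n. row_gap A i < t} = (\<Union>x\<in>{x. x $ i = 1}. {A. norm (x v* A) < t})"
    by (auto simp: row_gap_def cINF_less_iff[OF coord_one_nonempty row_gap_bdd])
  moreover have "open {A :: real^'n^'n. norm (x v* A) < t}" for x
    unfolding vector_matrix_mult_def by (intro open_Collect_less continuous_intros)
  ultimately show "{A \<in> space borel. row_gap A i < t} \<in> sets (borel :: (real^'n^'n) measure)"
    by (auto intro!: borel_open)
qed

text \<open>Row gaps bound the left action \<open>x v* A\<close> coordinate by coordinate, which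
  makes it injective and hence onto. Writing \<open>\<nu>\<close> as \<open>x v* A\<close> turns its
  squared norm into \<open>inner x (A *v \<nu>)\<close> and so transfers the bound to the right
  action; the factor \<open>CARD('n)\<close> is lost in summing coordinates.\<close>

lemma norm_le_of_row_gap:
  fixes A :: "real^'n^'n"
  assumes pos: "\<delta> > 0" and gap: "\<And>i. \<delta> \<le> row_gap A i"
  shows "\<delta> * norm \<nu> \<le> real CARD('n) * norm (A *v \<nu>)"
proof -
  have coord: "\<delta> * \<bar>x $ i\<bar> \<le> norm (x v* A)" for x i
    using mult_left_mono[OF gap, of "\<bar>x $ i\<bar>" i] row_gap_mult_le[of x i A] by (simp add: mult.commute)
  have "\<delta> * (\<Sum>i\<in>UNIV. \<bar>x $ i\<bar>) \<le> real CARD('n) * norm (x v* A)" for x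
    unfolding sum_distrib_left using sum_bounded_above[of UNIV "\<lambda>i. \<delta> * \<bar>x $ i\<bar>" "norm (x v* A)"] coord by simp
  then have low: "\<delta> * norm x \<le> real CARD('n) * norm (x v* A)" for x
    using mult_left_mono[OF norm_le_l1_cart[of x], of \<delta>] pos by (meson less_imp_le order_trans)
  have lin: "linear (\<lambda>x. x v* A)" 
    using matrix_vector_mul_linear[of "transpose A"] by (simp add: transpose_matrix_vector)
  have "inj (\<lambda>x. x v* A)"
    using lin unfolding linear_injective_0[OF lin]
  proof (intro allI impI)
    fix x assume "x v* A = 0"
    then have "\<delta> * norm x \<le> 0" using low[of x] by simp
    then show "x = 0" using pos by (simp add: mult_le_0_iff)
  qed
  then obtain x where x: "x v* A = \<nu>"
    using linear_injective_imp_surjective[OF lin] by (metis surjD)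
  have "norm \<nu> * norm \<nu> = inner x (A *v \<nu>)"
    by (simp add: x dot_square_norm power2_eq_square flip: dot_lmul_matrix)
  also have "\<dots> \<le> norm x * norm (A *v \<nu>)" by (rule norm_cauchy_schwarz)
  finally have "\<delta> * (norm \<nu> * norm \<nu>) \<le> (\<delta> * norm x) * norm (A *v \<nu>)"
    using pos by (simp add: mult.assoc)
  also have "\<dots> \<le> (real CARD('n) * norm \<nu>) * norm (A *v \<nu>)"
    using low[of x] x by (intro mult_right_mono) auto
  finally have "norm \<nu> * (\<delta> * norm \<nu>) \<le> norm \<nu> * (real CARD('n) * norm (A *v \<nu>))"
    by (simp add: ac_simps)
  then show ?thesis by (cases "norm \<nu> = 0") auto
qed

text \<open>Pairing a combination of rows with \<open>\<nu>\<close> leaves only row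
  \<open>i\<close>. A matrix quantity is thus reduced to a one-dimensional marginal.\<close>

lemma row_gap_ge_normal:
  fixes A :: "real^'n^'n"
  assumes "\<And>m. m \<noteq> i \<Longrightarrow> inner (A $ m) \<nu> = 0" "norm \<nu> = 1"
  shows "\<bar>inner (A $ i) \<nu>\<bar> \<le> row_gap A i"
  unfolding row_gap_def
proof (rule cINF_greatest[OF coord_one_nonempty])
  fix x :: "real^'n" assume x: "x \<in> {x. x $ i = 1}"
  have "inner (x v* A) \<nu> = (\<Sum>m\<in>UNIV. x $ m * inner (A $ m) \<nu>)"
    by (simp add: dot_lmul_matrix inner_vec_def[of x] matrix_vector_mul_component)
  also have "\<dots> = (\<Sum>m\<in>UNIV. if m = i then inner (A $ i) \<nu> else 0)"
    using assms(1) x by (intro sum.cong) auto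
  finally have "inner (A $ i) \<nu> = inner (x v* A) \<nu>" by simp
  then show "\<bar>inner (A $ i) \<nu>\<bar> \<le> norm (x v* A)"
    using Cauchy_Schwarz_ineq2[of "x v* A" \<nu>] assms(2) by simp
qed

lemma ex_unit_normal:
  fixes b :: "real^'n^'n"
  shows "\<exists>\<nu>. norm \<nu> = 1 \<and> (\<forall>m. m \<noteq> i \<longrightarrow> inner (b $ m) \<nu> = 0)"
proof -
  let ?R = "($) b ` (UNIV - {i})"
  have "dim ?R \<le> card ?R" by (rule dim_le_card) (auto intro: span_base)
  also have "\<dots> \<le> card (UNIV - {i} :: 'n set)" by (rule card_image_le) simp
  also have "\<dots> < DIM(real^'n)" by (simp add: card_Diff_singleton)
  finally obtain x where x: "x \<noteq> 0" "\<And>y. y \<in> span ?R \<Longrightarrow> orthogonal x y"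
    using orthogonal_to_subspace_exists by blast
  show ?thesis
  proof (intro exI[of _ "x /\<^sub>R norm x"] conjI allI impI)
    show "norm (x /\<^sub>R norm x) = 1" using x(1) by simp
    fix m assume "m \<noteq> i"
    then have "b $ m \<in> span ?R" by (intro span_base) auto
    then show "inner (b $ m) (x /\<^sub>R norm x) = 0" using x(2)[of "b $ m"] by (simp add: orthogonal_def inner_commute)
  qed
qed

text \<open>The exponent \<open>2/3\<close> is integrable at \<open>0\<close> on the line, and the product over three
  independent blocks of such factors controls the inverse square of the largest gap.\<close>

definition reg_pow :: "real \<Rightarrow> real \<Rightarrow> real" where
  "reg_pow \<tau> x = max x \<tau> powr (- 2 / 3)"

lemma reg_pow_nonneg [simp]: "0 \<le> reg_pow \<tau> x"
  by (simp add: reg_pow_def)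

lemma reg_pow_antimono: "0 < \<tau> \<Longrightarrow> x \<le> y \<Longrightarrow> reg_pow \<tau> y \<le> reg_pow \<tau> x"
  unfolding reg_pow_def by (intro powr_mono2') auto

lemma borel_measurable_reg_pow [measurable]: "reg_pow \<tau> \<in> borel_measurable borel"
  unfolding reg_pow_def[abs_def] by measurable

section \<open>One-dimensional integrability of the regularised power\<close>

lemma nn_integral_powr_unit:
  "(\<integral>\<^sup>+x. ennreal (if x \<in> {0..1} then x powr (- 2 / 3) else 0) \<partial>lborel) = 3"
proof -
  have "((\<lambda>x::real. if x \<in> {0..1} then x powr (- 2 / 3) else 0) has_integral 3) UNIV"
    using has_integral_powr_from_0[of "- 2 / 3" 1] unfolding has_integral_restrict_UNIV by simp
  then show ?thesis by (subst nn_integral_has_integral_lborel) auto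
qed

text \<open>The bound is 1 + 3 + 3. At distance more than 1 from the singularity the power is at
  most 1 and the normal mass is 1; within distance 1 the density is at most 1 and each side
  contributes the integral 3 of \<open>x powr (- 2 / 3)\<close> over the unit interval. Neither
  \<open>\<tau>\<close> nor the shift \<open>c\<close> enters.\<close>

lemma nn_integral_reg_pow_normal:
  assumes \<tau>: "\<tau> > 0"
  shows "(\<integral>\<^sup>+x. ennreal (reg_pow \<tau> \<bar>x + c\<bar>) \<partial>density lborel (normal_density 0 1)) \<le> 7"
proof -
  let ?g = "\<lambda>x::real. ennreal (if x \<in> {0..1} then x powr (- 2 / 3) else 0)"
  have phi: "normal_density 0 1 x \<le> 1" for x
  proof -
    have "1 \<le> sqrt (2 * pi)" using pi_gt3 by simp
    moreover have "exp (- (x\<^sup>2) / 2) \<le> 1" by simp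
    ultimately have "exp (- (x\<^sup>2) / 2) \<le> sqrt (2 * pi)" by linarith
    then show ?thesis by (simp add: normal_density_def field_simps)
  qed
  have shift: "(\<integral>\<^sup>+x. ?g (x + c) \<partial>lborel) = 3" "(\<integral>\<^sup>+x. ?g (- x - c) \<partial>lborel) = 3"
  proof -
    have "(\<integral>\<^sup>+x. f (x + c) \<partial>lborel) = (\<integral>\<^sup>+x. f x \<partial>lborel)"
      "(\<integral>\<^sup>+x. f (- x - c) \<partial>lborel) = (\<integral>\<^sup>+x. f x \<partial>lborel)"
      if "f \<in> borel_measurable borel" for f :: "real \<Rightarrow> ennreal"
      using nn_integral_real_affine[OF that, of 1 c] nn_integral_real_affine[OF that, of "- 1" "- c"]
      by (simp_all add: ac_simps)
    from this[of ?g] show "(\<integral>\<^sup>+x. ?g (x + c) \<partial>lborel) = 3" "(\<integral>\<^sup>+x. ?g (- x - c) \<partial>lborel) = 3"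
      unfolding nn_integral_powr_unit by simp_all
  qed
  have "(\<integral>\<^sup>+x. ennreal (reg_pow \<tau> \<bar>x + c\<bar>) \<partial>density lborel (normal_density 0 1))
      = (\<integral>\<^sup>+x. ennreal (normal_density 0 1 x) * ennreal (reg_pow \<tau> \<bar>x + c\<bar>) \<partial>lborel)"
    by (subst nn_integral_density) auto
  also have "\<dots> \<le> (\<integral>\<^sup>+x. ennreal (normal_density 0 1 x) + (?g (x + c) + ?g (- x - c)) \<partial>lborel)"
  proof (rule nn_integral_mono_AE)
    show "AE x in lborel. ennreal (normal_density 0 1 x) * ennreal (reg_pow \<tau> \<bar>x + c\<bar>)
      \<le> ennreal (normal_density 0 1 x) + (?g (x + c) + ?g (- x - c))"
      \<comment> \<open>At \<open>x = - c\<close> the comparison function is 0, because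
        \<open>0 powr (- 2 / 3) = 0\<close>, whereas \<open>reg_pow \<tau> 0\<close> is positive;
        that point is a null set.\<close>
      using AE_lborel_singleton[of "- c"]
    proof eventually_elim
      fix x :: real assume "x \<noteq> - c"
      then have nz: "0 < \<bar>x + c\<bar>" by auto
      let ?y = "\<bar>x + c\<bar>" and ?n = "normal_density 0 1 x"
      have n0: "?n \<ge> 0" by simp
      show "ennreal ?n * ennreal (reg_pow \<tau> ?y) \<le> ennreal ?n + (?g (x + c) + ?g (- x - c))"
      proof (cases "?y \<le> 1")
        case True
        have "ennreal ?n * ennreal (reg_pow \<tau> ?y) \<le> 1 * ennreal (?y powr (- 2 / 3))"
        proof (intro mult_mono)
          show "ennreal ?n \<le> 1" using phi by simp
          show "ennreal (reg_pow \<tau> ?y) \<le> ennreal (?y powr (- 2 / 3))"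
            unfolding reg_pow_def using nz by (intro ennreal_leI powr_mono2') auto
        qed auto
        also have "\<dots> \<le> ?g (x + c) + ?g (- x - c)"
          using True nz by (cases "x + c > 0") (auto simp: abs_if)
        finally show ?thesis by (simp add: add_increasing)
      next
        case False
        have "reg_pow \<tau> ?y \<le> 1"
          unfolding reg_pow_def using False powr_mono2'[of "- 2 / 3" 1 "max ?y \<tau>"] by auto
        then have "ennreal ?n * ennreal (reg_pow \<tau> ?y) \<le> ennreal ?n * 1"
          by (intro mult_left_mono) auto
        then show ?thesis by (simp add: add_increasing2)
      qed
    qed
  qed
  also have "\<dots> = (\<integral>\<^sup>+x. ennreal (normal_density 0 1 x) \<partial>lborel) + ((\<integral>\<^sup>+x. ?g (x + c) \<partial>lborel) + (\<integral>\<^sup>+x. ?g (- x - c) \<partial>lborel))"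
    by (simp add: nn_integral_add)
  also have "(\<integral>\<^sup>+x. ennreal (normal_density 0 1 x) \<partial>lborel) = 1"
    using prob_space.emeasure_space_1[OF prob_space_normal_density[of 1 0]] by (simp add: emeasure_density)
  finally show ?thesis using shift by simp
qed

lemma gaussian_rv_unit_distr:
  assumes "gaussian_rv M X 0 id" "norm \<nu> = 1"
  shows "distr M borel (\<lambda>\<omega>. inner (X \<omega>) \<nu>) = density lborel (normal_density 0 1)"
proof -
  have "inner \<nu> \<nu> = 1" using assms(2) by (simp add: dot_square_norm)
  moreover have "\<nu> \<noteq> 0" using assms(2) by auto
  ultimately show ?thesis using assms(1) by (simp add: gaussian_rv_def real_gaussian_def)
qed

lemma borel_measurable_vecI:
  fixes f :: "'a \<Rightarrow> ('b::euclidean_space)^'n"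
  assumes "\<And>i. (\<lambda>x. f x $ i) \<in> borel_measurable M"
  shows "f \<in> borel_measurable M"
  using assms by (subst borel_measurable_euclidean_space) (auto simp: Basis_vec_def inner_axis)

section \<open>Gaussian row gaps and blocks of differences\<close>

context prob_space
begin

text \<open>Fubini with all noises but \<open>Z j\<close> frozen. The other rows are then constants,
  so their unit normal \<open>\<nu>\<close> is one fixed vector, obtained without measurable
  selection, and \<open>Z j\<close> along \<open>\<nu>\<close> is standard normal. \<open>B\<close>
  carries the other rows and, in row \<open>i\<close>, the shift of \<open>Z j\<close>.\<close>

lemma row_gap_moment:
  fixes Z :: "'i \<Rightarrow> 'a \<Rightarrow> real^'n" and B :: "('i \<Rightarrow> real^'n) \<Rightarrow> real^'n^'n"
  assumes \<tau>: "\<tau> > 0" and ind: "indep_vars (\<lambda>_. borel) Z I" and j: "j \<in> I"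
    and Zj: "gaussian_rv M (Z j) 0 id"
    and B [measurable]: "B \<in> borel_measurable (PiM (I - {j}) (\<lambda>_. borel))"
  defines "Y \<equiv> \<lambda>\<omega>. B (restrict (\<lambda>n. Z n \<omega>) (I - {j}))"
  shows "(\<integral>\<^sup>+\<omega>. ennreal (reg_pow \<tau> (row_gap (\<chi> m. if m = i then Z j \<omega> + Y \<omega> $ i else Y \<omega> $ m) i)) \<partial>M) \<le> 7"
proof -
  let ?A = "\<lambda>b x. (\<chi> m. if m = i then x + b $ i else b $ m) :: real^'n^'n"
  let ?h = "\<lambda>b x. ennreal (reg_pow \<tau> (row_gap (?A b x) i))"
  let ?P = "\<lambda>J. PiM J (\<lambda>_. borel :: (real^'n) measure)"
  let ?U = "\<lambda>\<omega>. restrict (\<lambda>n. Z n \<omega>) (I - {j})" and ?V = "\<lambda>\<omega>. restrict (\<lambda>n. Z n \<omega>) {j}"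
  have iv: "indep_var (?P (I - {j})) ?U (?P {j}) ?V"
    using j by (intro indep_var_restrict[OF ind]) auto
  have [measurable]: "?U \<in> measurable M (?P (I - {j}))" "?V \<in> measurable M (?P {j})"
    using indep_var_rv1[OF iv] indep_var_rv2[OF iv] by auto
  have Zm [measurable]: "Z j \<in> borel_measurable M" using Zj by (simp add: gaussian_rv_def)
  have "continuous_on UNIV (\<lambda>p. ?A (fst p) (snd p))"
  proof (intro continuous_on_vec_lambda)
    show "continuous_on UNIV (\<lambda>p :: (real^'n^'n) \<times> (real^'n). if m = i then snd p + fst p $ i else fst p $ m)" for m
      by (cases "m = i")
         (auto intro!: continuous_on_add continuous_on_snd continuous_on_component continuous_on_fst continuous_on_id)
  qed
  then have [measurable]: "(\<lambda>p. ?A (fst p) (snd p)) \<in> borel_measurable (borel \<Otimes>\<^sub>M borel)"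
    unfolding borel_prod by (rule borel_measurable_continuous_onI)
  have h [measurable]: "(\<lambda>p. ?h (fst p) (snd p)) \<in> borel_measurable (borel \<Otimes>\<^sub>M borel)"
    by measurable
  have "(\<lambda>p. (B (fst p), snd p j)) \<in> measurable (?P (I - {j}) \<Otimes>\<^sub>M ?P {j}) (borel \<Otimes>\<^sub>M borel)"
    by (intro measurable_Pair measurable_compose[OF measurable_fst B]
        measurable_compose[OF measurable_snd measurable_component_singleton]) simp
  from measurable_compose[OF this h]
  have hB: "(\<lambda>p. ?h (B (fst p)) (snd p j)) \<in> borel_measurable (?P (I - {j}) \<Otimes>\<^sub>M ?P {j})"
    by (simp only: fst_conv snd_conv)
  interpret DV: prob_space "distr M (?P {j}) ?V" by (rule prob_space_distr) simp
  interpret DU: prob_space "distr M (?P (I - {j})) ?U" by (rule prob_space_distr) simp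
  have "(\<integral>\<^sup>+\<omega>. ?h (Y \<omega>) (Z j \<omega>) \<partial>M)
      = (\<integral>\<^sup>+p. ?h (B (fst p)) (snd p j) \<partial>distr M (?P (I - {j}) \<Otimes>\<^sub>M ?P {j}) (\<lambda>\<omega>. (?U \<omega>, ?V \<omega>)))"
    using hB by (subst nn_integral_distr) (auto simp: Y_def cong: if_cong)
  also have "\<dots> = (\<integral>\<^sup>+p. ?h (B (fst p)) (snd p j) \<partial>(distr M (?P (I - {j})) ?U \<Otimes>\<^sub>M distr M (?P {j}) ?V))"
    using iv unfolding indep_var_distribution_eq by simp
  also have "\<dots> = (\<integral>\<^sup>+u. \<integral>\<^sup>+v. ?h (B u) (v j) \<partial>distr M (?P {j}) ?V \<partial>distr M (?P (I - {j})) ?U)"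
    using DV.nn_integral_fst[of "\<lambda>p. ?h (B (fst p)) (snd p j)" "distr M (?P (I - {j})) ?U"] hB
    by (simp cong: if_cong)
  also have "\<dots> \<le> (\<integral>\<^sup>+u. 7 \<partial>distr M (?P (I - {j})) ?U)"
  proof (rule nn_integral_mono)
    fix u :: "'i \<Rightarrow> real^'n"
    define b where "b = B u"
    obtain \<nu> :: "real^'n" where \<nu>: "norm \<nu> = 1" "\<And>m. m \<noteq> i \<Longrightarrow> inner (b $ m) \<nu> = 0"
      using ex_unit_normal[of i b] by auto
    have "(\<lambda>v. (b, v j)) \<in> measurable (?P {j}) (borel \<Otimes>\<^sub>M borel)"
      by (intro measurable_Pair measurable_const measurable_component_singleton) auto
    from measurable_compose[OF this h]
    have hb: "(\<lambda>v. ?h b (v j)) \<in> borel_measurable (?P {j})" by (simp only: fst_conv snd_conv)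
    have "(\<integral>\<^sup>+v. ?h b (v j) \<partial>distr M (?P {j}) ?V) = (\<integral>\<^sup>+\<omega>. ?h b (Z j \<omega>) \<partial>M)"
      using hb by (subst nn_integral_distr) (auto cong: if_cong)
    also have "\<dots> \<le> (\<integral>\<^sup>+\<omega>. ennreal (reg_pow \<tau> \<bar>inner (Z j \<omega>) \<nu> + inner (b $ i) \<nu>\<bar>) \<partial>M)"
    proof (intro nn_integral_mono ennreal_leI reg_pow_antimono \<tau>)
      fix \<omega>
      show "\<bar>inner (Z j \<omega>) \<nu> + inner (b $ i) \<nu>\<bar> \<le> row_gap (?A b (Z j \<omega>)) i"
        using row_gap_ge_normal[of i "?A b (Z j \<omega>)" \<nu>] \<nu> by (simp add: inner_add_left)
    qed
    also have "\<dots> = (\<integral>\<^sup>+t. ennreal (reg_pow \<tau> \<bar>t + inner (b $ i) \<nu>\<bar>) \<partial>distr M borel (\<lambda>\<omega>. inner (Z j \<omega>) \<nu>))"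
      by (simp add: nn_integral_distr)
    also have "\<dots> \<le> 7"
      unfolding gaussian_rv_unit_distr[OF Zj \<nu>(1)] by (rule nn_integral_reg_pow_normal[OF \<tau>])
    finally show "(\<integral>\<^sup>+v. ?h (B u) (v j) \<partial>distr M (?P {j}) ?V) \<le> 7" unfolding b_def .
  qed
  also have "\<dots> = 7"
    using DU.emeasure_space_1 by simp
  finally show ?thesis .
qed

text \<open>Differences of neighbouring particles do not see \<open>c\<close>, so the bound also
  holds at a random centre such as the empirical mean. The floor \<open>\<tau>\<close> keeps
  \<open>W\<close> finite and the bound valid where the Gram matrix is singular, at the price of the
  term with \<open>\<tau>\<^sup>2\<close>; the moment of \<open>W\<close> does not feel it. That
  moment is 7 for each row, \<open>CARD('n)\<close> rows, three blocks.\<close>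

lemma gaussian_gram_lower_bound:
  fixes Z :: "nat \<Rightarrow> 'a \<Rightarrow> real^'n"
  assumes \<tau>: "\<tau> > 0" and ind: "indep_vars (\<lambda>_. borel) Z {..<N}"
    and Z: "\<And>n. n < N \<Longrightarrow> gaussian_rv M (Z n) 0 id" and N: "6 * CARD('n) \<le> N"
  obtains W where "W \<in> borel_measurable M" "\<And>\<omega>. W \<omega> > 0"
    "(\<integral>\<^sup>+\<omega>. ennreal (W \<omega>) \<partial>M) \<le> ennreal ((7 * real CARD('n)) ^ 3)"
    "\<And>\<omega> \<nu> c. (norm \<nu>)\<^sup>2 \<le> W \<omega> * (\<tau>\<^sup>2 * (norm \<nu>)\<^sup>2 + 2 * (real CARD('n))\<^sup>2 * (\<Sum>n<N. (inner (Z n \<omega> - c) \<nu>)\<^sup>2))"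
proof -
  let ?k = "CARD('n)"
  have k: "?k > 0" by simp
  obtain e :: "'n \<Rightarrow> nat" where e: "bij_betw e UNIV {..<?k}"
    using ex_bij_betw_finite_nat[of "UNIV :: 'n set"] by (auto simp: lessThan_atLeast0)
  have ek: "e m < ?k" for m using e by (auto simp: bij_betw_def)
  have ei: "e m = e m' \<longleftrightarrow> m = m'" for m m' using e by (auto simp: bij_betw_def inj_on_def)
  \<comment> \<open>The first member of the pair forming row \<open>m\<close> of block
    \<open>l\<close>. It is even, so it is never the second member of a pair.\<close>
  define f where "f l m = 2 * ?k * l + 2 * e m" for l m
  define D where "D l z = (\<chi> m. z (f l m) - z (Suc (f l m)))" for l :: nat and z :: "nat \<Rightarrow> real^'n"
  define K where "K l = {2 * ?k * l..<2 * ?k * Suc l}" for l :: nat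
  define h where "h l z = (\<Sum>i\<in>UNIV. reg_pow \<tau> (row_gap (D l z) i))" for l z
  define W where "W \<omega> = (\<Prod>l<3. h l (\<lambda>n. Z n \<omega>))" for \<omega>
  have fK: "f l m \<in> K l" "Suc (f l m) \<in> K l" for l m
    using ek[of m] by (auto simp: f_def K_def)
  have KN: "K l \<subseteq> {..<N}" if "l < 3" for l
  proof -
    have "2 * ?k * Suc l \<le> 2 * ?k * 3" using that by (intro mult_le_mono) auto
    also have "\<dots> \<le> N" using N by simp
    finally show ?thesis unfolding K_def by (meson atLeastLessThan_iff lessThan_iff order_less_le_trans subsetI)
  qed
  have Kdisj: "disjoint_family_on K {..<3}"
    unfolding disjoint_family_on_def
  proof (intro ballI impI)
    fix l l' :: nat assume "l \<noteq> l'"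
    then have "Suc l \<le> l' \<or> Suc l' \<le> l" by auto
    then have "2 * ?k * Suc l \<le> 2 * ?k * l' \<or> 2 * ?k * Suc l' \<le> 2 * ?k * l"
      using mult_le_mono2 by blast
    then show "K l \<inter> K l' = {}" by (auto simp: K_def)
  qed
  have DK: "D l (restrict z (K l)) = D l z" for l z
    by (simp add: D_def fK cong: if_cong)
  have Dm: "D l \<in> borel_measurable (PiM (K l) (\<lambda>_. borel))" for l
  proof (rule borel_measurable_vecI)
    show "(\<lambda>z. D l z $ m) \<in> borel_measurable (PiM (K l) (\<lambda>_. borel))" for m
      unfolding D_def vec_lambda_beta using fK[of l m] by measurable
  qed
  have hm: "h l \<in> borel_measurable (PiM (K l) (\<lambda>_. borel))" for l
    unfolding h_def[abs_def]
    by (intro borel_measurable_sum measurable_compose[OF _ borel_measurable_reg_pow]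
        measurable_compose[OF Dm borel_measurable_row_gap])
  have h_pos: "h l z > 0" for l z
    unfolding h_def using \<tau> by (intro sum_pos) (auto simp: reg_pow_def)
  have Wpos: "W \<omega> > 0" for \<omega> by (simp add: W_def prod_pos h_pos)
  have ind3: "indep_vars (\<lambda>l. PiM (K l) (\<lambda>_. borel)) (\<lambda>l \<omega>. restrict (\<lambda>n. Z n \<omega>) (K l)) {..<3}"
    using KN Kdisj by (intro indep_vars_restrict[OF ind]) auto
  have ind_h: "indep_vars (\<lambda>_. borel) (\<lambda>l \<omega>. ennreal (h l (restrict (\<lambda>n. Z n \<omega>) (K l)))) {..<3}"
    using indep_vars_compose2[OF ind3, of "\<lambda>l z. ennreal (h l z)" "\<lambda>_. borel"] hm by auto
  \<comment> \<open>Each factor reads only its own block of coordinates, so independence of the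
    restrictions is independence of the factors themselves.\<close>
  have hK: "h l (restrict z (K l)) = h l z" for l z by (simp add: h_def DK)
  note ind_h = ind_h[unfolded hK]
  have hZm: "(\<lambda>\<omega>. h l (\<lambda>n. Z n \<omega>)) \<in> borel_measurable M" if "l < 3" for l
  proof -
    have "(\<lambda>\<omega>. restrict (\<lambda>n. Z n \<omega>) (K l)) \<in> measurable M (PiM (K l) (\<lambda>_. borel))"
      using ind3 that by (auto simp: indep_vars_def)
    from measurable_compose[OF this hm] show ?thesis by (simp only: hK)
  qed
  have Wm: "W \<in> borel_measurable M"
    unfolding W_def[abs_def] using hZm by (intro borel_measurable_prod) auto
  have gap: "(\<integral>\<^sup>+\<omega>. ennreal (reg_pow \<tau> (row_gap (D l (\<lambda>n. Z n \<omega>)) i)) \<partial>M) \<le> 7" if l: "l < 3" for l i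
  proof -
    let ?j = "f l i"
    \<comment> \<open>The first particle of row \<open>i\<close> is the Gaussian to be integrated;
      its partner, negated, acts as the shift.\<close>
    let ?B = "\<lambda>z. (\<chi> m. if m = i then - z (Suc (f l i)) else z (f l m) - z (Suc (f l m))) :: real^'n^'n"
    have j: "?j \<in> {..<N}" using KN[OF l] fK by blast
    have ne: "f l m \<noteq> ?j" if "m \<noteq> i" for m using that by (simp add: f_def ei)
    have ne': "Suc (f l m) \<noteq> ?j" for m
    proof -
      have "even (f l i)" "even (f l m)" by (auto simp: f_def)
      then show ?thesis by (metis even_Suc)
    qed
    have mem: "Suc (f l m) \<in> {..<N} - {?j}" "m \<noteq> i \<Longrightarrow> f l m \<in> {..<N} - {?j}" for m
      using KN[OF l] fK[of l m] ne ne' by auto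
    have Bm: "?B \<in> borel_measurable (PiM ({..<N} - {?j}) (\<lambda>_. borel))"
    proof (rule borel_measurable_vecI)
      show "(\<lambda>z. ?B z $ m) \<in> borel_measurable (PiM ({..<N} - {?j}) (\<lambda>_. borel))" for m
        unfolding vec_lambda_beta
        using mem[of m] by (cases "m = i") (auto intro!: borel_measurable_diff borel_measurable_uminus measurable_component_singleton)
    qed
    have eq: "(\<chi> m. if m = i then Z ?j \<omega> + ?B (restrict (\<lambda>n. Z n \<omega>) ({..<N} - {?j})) $ i
        else ?B (restrict (\<lambda>n. Z n \<omega>) ({..<N} - {?j})) $ m) = D l (\<lambda>n. Z n \<omega>)" for \<omega>
      using mem by (auto simp: D_def vec_eq_iff)
    show ?thesis
      using row_gap_moment[OF \<tau> ind j Z Bm, of i] j unfolding eq by simp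
  qed
  have "(\<integral>\<^sup>+\<omega>. ennreal (W \<omega>) \<partial>M) = (\<integral>\<^sup>+\<omega>. (\<Prod>l<3. ennreal (h l (\<lambda>n. Z n \<omega>))) \<partial>M)"
    by (simp add: W_def prod_ennreal less_imp_le[OF h_pos])
  also have "\<dots> = (\<Prod>l<3. \<integral>\<^sup>+\<omega>. ennreal (h l (\<lambda>n. Z n \<omega>)) \<partial>M)"
    by (rule indep_vars_nn_integral[OF _ ind_h]) auto
  also have "\<dots> \<le> (\<Prod>l<(3::nat). ennreal (7 * real ?k))"
  proof (rule prod_mono_ennreal)
    fix l :: nat assume "l \<in> {..<3}"
    then have l: "l < 3" by simp
    have m: "(\<lambda>\<omega>. reg_pow \<tau> (row_gap (D l (\<lambda>n. Z n \<omega>)) i)) \<in> borel_measurable M" for i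
    proof -
      have "(\<lambda>\<omega>. restrict (\<lambda>n. Z n \<omega>) (K l)) \<in> measurable M (PiM (K l) (\<lambda>_. borel))"
        using ind3 l by (auto simp: indep_vars_def)
      from measurable_compose[OF this Dm] have "(\<lambda>\<omega>. D l (\<lambda>n. Z n \<omega>)) \<in> borel_measurable M"
        by (simp only: DK)
      then show ?thesis by measurable
    qed
    have "(\<integral>\<^sup>+\<omega>. ennreal (h l (\<lambda>n. Z n \<omega>)) \<partial>M)
        = (\<Sum>i\<in>UNIV. \<integral>\<^sup>+\<omega>. ennreal (reg_pow \<tau> (row_gap (D l (\<lambda>n. Z n \<omega>)) i)) \<partial>M)"
      unfolding h_def sum_ennreal[symmetric, OF reg_pow_nonneg] using m by (intro nn_integral_sum) auto
    also have "\<dots> \<le> (\<Sum>i\<in>(UNIV :: 'n set). 7)" by (intro sum_mono gap l)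
    also have "\<dots> = ennreal (7 * real ?k)"
      by (simp add: ennreal_mult' ennreal_of_nat_eq_real_of_nat mult.commute)
    finally show "(\<integral>\<^sup>+\<omega>. ennreal (h l (\<lambda>n. Z n \<omega>)) \<partial>M) \<le> ennreal (7 * real ?k)" .
  qed
  also have "\<dots> = ennreal ((7 * real ?k) ^ 3)"
    by (simp add: ennreal_power[symmetric] ennreal_mult)
  finally have EW: "(\<integral>\<^sup>+\<omega>. ennreal (W \<omega>) \<partial>M) \<le> ennreal ((7 * real ?k) ^ 3)" .
  have low: "(norm \<nu>)\<^sup>2 \<le> W \<omega> * (\<tau>\<^sup>2 * (norm \<nu>)\<^sup>2 + 2 * (real ?k)\<^sup>2 * (\<Sum>n<N. (inner (Z n \<omega> - c) \<nu>)\<^sup>2))" for \<omega> \<nu> c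
  proof -
    let ?z = "\<lambda>n. Z n \<omega>"
    let ?F = "\<Sum>n<N. (inner (?z n - c) \<nu>)\<^sup>2"
    define \<mu> where "\<mu> l = Min (range (row_gap (D l ?z)))" for l
    have \<mu>in: "\<mu> l \<in> range (row_gap (D l ?z))" for l unfolding \<mu>_def by (rule Min_in) auto
    have \<mu>le: "\<mu> l \<le> row_gap (D l ?z) i" for l i unfolding \<mu>_def by (rule Min_le) auto
    have h\<mu>: "reg_pow \<tau> (\<mu> l) \<le> h l ?z" for l
    proof -
      obtain i where "\<mu> l = row_gap (D l ?z) i" using \<mu>in by blast
      then show ?thesis
        unfolding h_def using member_le_sum[of i UNIV "\<lambda>i. reg_pow \<tau> (row_gap (D l ?z) i)"] by simp
    qed
    \<comment> \<open>The best of the three blocks, floored by \<open>\<tau>\<close>. Every factor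
      of \<open>W\<close> is at least \<open>\<sigma> powr (- 2 / 3)\<close>, so the three together
      give the inverse square.\<close>
    define \<sigma> where "\<sigma> = Max (insert \<tau> (\<mu> ` {..<3}))"
    have \<sigma>: "\<sigma> \<in> insert \<tau> (\<mu> ` {..<3})" "\<tau> \<le> \<sigma>" "l < 3 \<Longrightarrow> \<mu> l \<le> \<sigma>" for l
      unfolding \<sigma>_def by (rule Max_in) (auto intro: Max_ge)
    have \<sigma>0: "\<sigma> > 0" using \<sigma>(2) \<tau> by linarith
    have "\<sigma> powr (- 2 / 3) \<le> h l ?z" if "l < 3" for l
    proof (rule order_trans[OF _ h\<mu>])
      show "\<sigma> powr (- 2 / 3) \<le> reg_pow \<tau> (\<mu> l)"
        unfolding reg_pow_def using \<tau> \<sigma> that by (intro powr_mono2') auto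
    qed
    then have "(\<Prod>l<(3::nat). \<sigma> powr (- 2 / 3)) \<le> W \<omega>"
      unfolding W_def by (intro prod_mono) auto
    also have "(\<Prod>l<(3::nat). \<sigma> powr (- 2 / 3)) = (\<sigma> powr (- 2 / 3)) ^ 3" by simp
    also have "\<dots> = \<sigma> powr (- 2)" using \<sigma>0 powr_power[of \<sigma> "- 2 / 3" 3] by simp
    also have "\<dots> = inverse (\<sigma>\<^sup>2)"
      using \<sigma>0 by (simp add: powr_minus powr_numeral)
    finally have "1 \<le> W \<omega> * \<sigma>\<^sup>2" using \<sigma>0 by (simp add: field_simps)
    then have 1: "(norm \<nu>)\<^sup>2 \<le> W \<omega> * (\<sigma>\<^sup>2 * (norm \<nu>)\<^sup>2)"
      using mult_right_mono[of 1 "W \<omega> * \<sigma>\<^sup>2" "(norm \<nu>)\<^sup>2"] by (simp add: mult.assoc)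
    have F0: "?F \<ge> 0" by (simp add: sum_nonneg)
    have "\<sigma>\<^sup>2 * (norm \<nu>)\<^sup>2 \<le> \<tau>\<^sup>2 * (norm \<nu>)\<^sup>2 + 2 * (real ?k)\<^sup>2 * ?F"
    \<comment> \<open>At the floor the term with \<open>\<tau>\<^sup>2\<close> suffices; otherwise
      the block attaining \<open>\<sigma>\<close> supplies the Gram term.\<close>
    proof (cases "\<sigma> = \<tau>")
      case True
      then show ?thesis using F0 by simp
    next
      case False
      then obtain l where l: "l < 3" "\<sigma> = \<mu> l" using \<sigma>(1) by auto
      have "\<sigma> * norm \<nu> \<le> real ?k * norm (D l ?z *v \<nu>)"
        using \<sigma>0 \<mu>le l by (intro norm_le_of_row_gap) auto
      then have "(\<sigma> * norm \<nu>)\<^sup>2 \<le> (real ?k * norm (D l ?z *v \<nu>))\<^sup>2"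
        using \<sigma>0 by (intro power_mono) auto
      also have "\<dots> = (real ?k)\<^sup>2 * (norm (D l ?z *v \<nu>))\<^sup>2" by (simp add: power_mult_distrib)
      also have "\<dots> \<le> (real ?k)\<^sup>2 * (2 * ?F)"
      proof (rule mult_left_mono)
        let ?p = "\<lambda>n. (inner (?z n - c) \<nu>)\<^sup>2"
        have "(norm (D l ?z *v \<nu>))\<^sup>2 = (\<Sum>m\<in>UNIV. (inner (?z (f l m) - ?z (Suc (f l m))) \<nu>)\<^sup>2)"
          unfolding power2_norm_eq_inner inner_vec_def[of "D l ?z *v \<nu>"]
          by (simp add: matrix_vector_mul_component D_def power2_eq_square)
        also have "\<dots> \<le> (\<Sum>m\<in>UNIV. 2 * (?p (f l m) + ?p (Suc (f l m))))"
        proof (rule sum_mono)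
          fix m
          have "(x - y)\<^sup>2 \<le> 2 * (x\<^sup>2 + y\<^sup>2)" for x y :: real
            using sum_squares_bound[of x "- y"] by (simp add: power2_diff algebra_simps)
          from this[of "inner (?z (f l m) - c) \<nu>" "inner (?z (Suc (f l m)) - c) \<nu>"]
          show "(inner (?z (f l m) - ?z (Suc (f l m))) \<nu>)\<^sup>2 \<le> 2 * (?p (f l m) + ?p (Suc (f l m)))"
            by (simp add: inner_diff_left)
        qed
        also have "\<dots> = 2 * (sum ?p (range (f l)) + sum ?p (range (\<lambda>m. Suc (f l m))))"
        proof -
          have "inj (f l)" "inj (\<lambda>m. Suc (f l m))" by (auto simp: inj_def f_def ei)
          then show ?thesis by (simp add: sum.reindex sum.distrib sum_distrib_left)
        qed
        also have "\<dots> = 2 * sum ?p (range (f l) \<union> range (\<lambda>m. Suc (f l m)))"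
        proof -
          have "f l m \<noteq> Suc (f l m')" for m m'
          proof -
            have "even (f l m)" "even (f l m')" by (auto simp: f_def)
            then show ?thesis by (metis even_Suc)
          qed
          then show ?thesis by (subst sum.union_disjoint) auto
        qed
        also have "\<dots> \<le> 2 * ?F"
        proof -
          have "f l m \<in> {..<N}" "Suc (f l m) \<in> {..<N}" for m using KN[OF l(1)] fK by blast+
          then show ?thesis by (intro mult_left_mono sum_mono2) auto
        qed
        finally show "(norm (D l ?z *v \<nu>))\<^sup>2 \<le> 2 * ?F" .
      qed simp
      finally show ?thesis by (simp add: power_mult_distrib algebra_simps add_increasing)
    qed
    then show ?thesis using 1 mult_left_mono[OF _ less_imp_le[OF Wpos[of \<omega>]]] by (meson order_trans)
  qed
  show ?thesis by (rule that[OF Wm Wpos EW low])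
qed

end

section \<open>Pathwise recursions for spread and error\<close>

lemma emp_mean_norm_sq_le:
  fixes v :: "nat \<Rightarrow> 'a::real_inner"
  assumes "N > 0"
  shows "real N * (norm (emp_mean N v))\<^sup>2 \<le> (\<Sum>n<N. (norm (v n))\<^sup>2)"
  using sum_norm_sq_shift[OF assms, of v 0] by (simp add: sum_nonneg)

lemma emp_mean_norm_le_sqrt:
  fixes v :: "nat \<Rightarrow> 'a::real_normed_vector"
  assumes "N > 0"
  shows "(1 / real N) * (\<Sum>n<N. norm (v n)) \<le> sqrt ((1 / real N) * (\<Sum>n<N. (norm (v n))\<^sup>2))"
proof (rule real_le_rsqrt)
  have "(\<Sum>n<N. norm (v n)) \<le> sqrt (\<Sum>n<N. (norm (v n))\<^sup>2) * sqrt (real N)"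
    using L2_set_mult_ineq[of "\<lambda>n. norm (v n)" "\<lambda>_. 1" "{..<N}"] by (simp add: L2_set_def)
  then have "(\<Sum>n<N. norm (v n))\<^sup>2 \<le> (sqrt (\<Sum>n<N. (norm (v n))\<^sup>2) * sqrt (real N))\<^sup>2"
    by (intro power_mono sum_nonneg) auto
  also have "\<dots> = (\<Sum>n<N. (norm (v n))\<^sup>2) * real N"
    by (simp add: power_mult_distrib sum_nonneg)
  finally show "((1 / real N) * (\<Sum>n<N. norm (v n)))\<^sup>2 \<le> (1 / real N) * (\<Sum>n<N. (norm (v n))\<^sup>2)"
    using assms by (simp add: power_mult_distrib power_divide power2_eq_square field_simps)
qed

text \<open>Lets each noise norm enter through its square, whose expectation the covariance
  supplies.\<close>

lemma le_one_plus_sq: "x \<le> 1 + x\<^sup>2" for x :: real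
proof -
  have "2 * x \<le> x\<^sup>2 + 1" using sum_squares_bound[of x 1] by simp
  then show ?thesis using zero_le_power2[of x] by linarith
qed

text \<open>A single realisation, so every estimate here is deterministic. Note the index shift:
  \<open>w j\<close>, \<open>v j\<close>, \<open>\<mu> j\<close> and \<open>\<Sigma> j\<close> are
  built from the analysis ensemble at \<open>j\<close> (with the noise at \<open>Suc j\<close> where
  it enters) and belong to the forecast for time \<open>Suc j\<close>.\<close>

locale enkf_path = weighted_observation H Hadj \<beta>
  for H :: "'h::{real_inner, complete_space} \<Rightarrow> real^'k" and Hadj :: "real^'k \<Rightarrow> 'h" and \<beta> :: real +
  fixes \<Psi> :: "'h \<Rightarrow> 'h" and R :: "real^'k^'k" and r L \<alpha> \<rho> b a \<epsilon> :: real and N :: nat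
    and u :: "nat \<Rightarrow> 'h" and U :: "nat \<Rightarrow> nat \<Rightarrow> 'h" and \<zeta> :: "nat \<Rightarrow> nat \<Rightarrow> real^'k" and \<eta> :: "nat \<Rightarrow> real^'k"
    and w v :: "nat \<Rightarrow> nat \<Rightarrow> 'h" and \<mu> :: "nat \<Rightarrow> 'h" and \<Sigma> :: "nat \<Rightarrow> 'h \<Rightarrow> 'h"
  assumes A: "assumption_A \<Psi> (Hadj \<circ> H) r \<beta> L \<alpha>"
    and rho: "\<rho> > 0" "\<And>x. \<rho> * (norm x)\<^sup>2 \<le> inner (R *v x) x"
    and R_norm: "\<And>x. norm (R *v x) \<le> b * norm x"
    and R_sym: "\<And>x y. inner (R *v x) y = inner x (R *v y)"
    and eps: "\<epsilon> > 0" and a: "a > 0" and N: "N \<ge> 2"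
    and signal: "\<And>j. u (Suc j) = \<Psi> (u j)"
  defines "w \<equiv> \<lambda>j n. \<Psi> (proj_BV r \<beta> (Hadj \<circ> H) (U j n))"
    and "v \<equiv> \<lambda>j n. w j n + sqrt a *\<^sub>R Hadj (\<zeta> (Suc j) n)"
    and "\<mu> \<equiv> \<lambda>j. emp_mean N (v j)"
    and "\<Sigma> \<equiv> \<lambda>j x. (1 / real N) *\<^sub>R outer_sum N (v j) (\<mu> j) x"
  assumes mean: "\<And>j. emp_mean N (U (Suc j)) = \<mu> j
      + kalman_gain H Hadj R \<epsilon> (\<Sigma> j) (H (u (Suc j)) + \<epsilon> *\<^sub>R \<eta> (Suc j) - H (\<mu> j))"
    and cov: "\<And>j x. (1 / real (N - 1)) *\<^sub>R outer_sum N (U (Suc j)) (emp_mean N (U (Suc j))) x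
      = \<Sigma> j x - kalman_gain H Hadj R \<epsilon> (\<Sigma> j) (H (\<Sigma> j x))"
begin

lemma const: "r > 0" "L > 0" "0 < \<alpha>" "\<alpha> < 1"
  using A by (auto simp: assumption_A_def)

lemma N0: "N > 0" "real N > 0" "real (N - 1) > 0"
  using N by auto

text \<open>This is the spread; the innovation covariance of the step is \<open>step.S\<close>. The
  normalisations, \<open>N - 1\<close> here and \<open>N\<close> in \<open>spreadQ\<close>, are
  those of the analysis and forecast covariances; passing between them only drops a factor below
  1.\<close>

definition S :: "nat \<Rightarrow> real" where
  "S j = (1 / real (N - 1)) * (\<Sum>n<N. (norm (T (U j n - emp_mean N (U j))))\<^sup>2)"

definition spreadQ :: "nat \<Rightarrow> real" where
  "spreadQ j = (1 / real N) * (\<Sum>n<N. (norm (Q (v j n - \<mu> j)))\<^sup>2)"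

definition trR :: real where "trR = (\<Sum>i\<in>UNIV. R $ i $ i)"

lemma S_nonneg: "0 \<le> S j"
  by (simp add: S_def sum_nonneg)

lemma trR_nonneg: "0 \<le> trR"
  unfolding trR_def
proof (rule sum_nonneg)
  fix i
  have "0 \<le> \<rho> * (norm (axis i 1 :: real^'k))\<^sup>2" using rho(1) by simp
  also have "\<dots> \<le> inner (R *v axis i 1) (axis i 1)" by (rule rho(2))
  also have "\<dots> = R $ i $ i" by (simp add: inner_axis matrix_vector_mult_basis column_def)
  finally show "0 \<le> R $ i $ i" .
qed

lemma b_nonneg: "b \<ge> 0"
  using order_trans[OF norm_ge_zero R_norm, of "axis undefined 1"] by (simp add: norm_axis_1)

lemma proj_in: "norm (proj_BV r \<beta> (Hadj \<circ> H) x) \<le> r"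
  using proj_BV_nearest(1)[of r x] const(1) by simp

lemma Psi_in: "norm x \<le> r \<Longrightarrow> norm (\<Psi> x) \<le> r"
  using A unfolding assumption_A_def absorbing_forward_invariant_def by (force simp: image_subset_iff)

lemma w_in: "norm (w j n) \<le> r"
  unfolding w_def by (rule Psi_in[OF proj_in])

lemma Psi_lip:
  assumes "norm x \<le> r" "norm y \<le> r"
  shows "(norm (T (\<Psi> x - \<Psi> y)))\<^sup>2 \<le> L * (norm (T (x - y)))\<^sup>2"
  using A assms unfolding assumption_A_def Vnorm_eq by auto

lemma Psi_squeeze:
  assumes "norm x \<le> r" "norm y \<le> r"
  shows "(norm (Q (\<Psi> x - \<Psi> y)))\<^sup>2 \<le> \<alpha> * (norm (T (x - y)))\<^sup>2"
proof -
  have "(Vnorm \<beta> (Hadj \<circ> H) ((\<Psi> x - \<Psi> y) - (Hadj \<circ> H) (\<Psi> x - \<Psi> y)))\<^sup>2 \<le> \<alpha> * (Vnorm \<beta> (Hadj \<circ> H) (x - y))\<^sup>2"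
    using A assms unfolding assumption_A_def by auto
  moreover have "(\<Psi> x - \<Psi> y) - (Hadj \<circ> H) (\<Psi> x - \<Psi> y) = Q (\<Psi> x - \<Psi> y)" by (simp add: Q_def)
  ultimately show ?thesis by (simp add: Vnorm_eq norm_T_Q)
qed

lemma proj_sq: "(norm (T (proj_BV r \<beta> (Hadj \<circ> H) x - proj_BV r \<beta> (Hadj \<circ> H) y)))\<^sup>2 \<le> (norm (T (x - y)))\<^sup>2"
  using const(1) by (intro power_mono proj_BV_nonexpansive) auto

lemma w_lip: "(norm (T (w j n - w j m)))\<^sup>2 \<le> L * (norm (T (U j n - U j m)))\<^sup>2"
  unfolding w_def by (rule order_trans[OF Psi_lip[OF proj_in proj_in] mult_left_mono[OF proj_sq]]) (use const in simp)

lemma w_squeeze: "(norm (Q (w j n - w j m)))\<^sup>2 \<le> \<alpha> * (norm (T (U j n - U j m)))\<^sup>2"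
  unfolding w_def by (rule order_trans[OF Psi_squeeze[OF proj_in proj_in] mult_left_mono[OF proj_sq]]) (use const in simp)

lemma mu_eq: "\<mu> j = emp_mean N (w j) + sqrt a *\<^sub>R Hadj (emp_mean N (\<zeta> (Suc j)))"
  unfolding \<mu>_def v_def emp_mean_add emp_mean_linear[OF Hadj.linear_axioms]
  by (subst emp_mean_linear[where f = "\<lambda>x. sqrt a *\<^sub>R Hadj x"])
     (auto intro!: linear_compose_scale_right Hadj.linear_axioms)

text \<open>Inflation acts in the range of \<open>Hadj\<close>, which \<open>Q\<close> annihilates.
  So no inflation noise enters the spread recursion, and it holds on every path.\<close>

lemma Q_dev: "Q (v j n - \<mu> j) = Q (w j n) - emp_mean N (\<lambda>n. Q (w j n))"
  by (simp add: mu_eq v_def Q.diff Q.add Q.scaleR Q_Hadj emp_mean_linear[OF Q.linear_axioms])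

lemma H_dev: "H (v j n - \<mu> j) = H (w j n - emp_mean N (w j)) + sqrt a *\<^sub>R (\<zeta> (Suc j) n - emp_mean N (\<zeta> (Suc j)))"
  by (simp add: mu_eq v_def H.diff H.add H.scaleR HHadj scaleR_diff_right)

lemma T_spread:
  "(\<Sum>n<N. (norm (T (U j n) - emp_mean N (\<lambda>n. T (U j n))))\<^sup>2) = real (N - 1) * S j"
  using N0 by (simp add: S_def emp_mean_linear[OF T.linear_axioms] T.diff)

lemma spreadQ_le: "spreadQ j \<le> \<alpha> * S j"
proof -
  have "(\<Sum>n<N. (norm (Q (v j n - \<mu> j)))\<^sup>2) \<le> \<alpha> * (real (N - 1) * S j)"
    unfolding Q_dev T_spread[symmetric]
    by (rule spread_contraction[OF N0(1)]) (use w_squeeze in \<open>simp add: Q.diff T.diff\<close>)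
  also have "\<dots> \<le> \<alpha> * (real N * S j)"
    using const S_nonneg[of j] by (intro mult_left_mono mult_right_mono) auto
  finally show ?thesis using N0 by (simp add: spreadQ_def field_simps)
qed

lemma spreadQ_le_r: "spreadQ j \<le> r\<^sup>2"
proof -
  have "(\<Sum>n<N. (norm (Q (v j n - \<mu> j)))\<^sup>2) \<le> (\<Sum>n<N. (norm (Q (w j n) - 0))\<^sup>2)"
    unfolding Q_dev by (rule sum_norm_sq_emp_mean_le[OF N0(1)])
  also have "\<dots> \<le> (\<Sum>n<N. r\<^sup>2)"
    using order_trans[OF norm_Q_le w_in] by (intro sum_mono power_mono) auto
  finally show ?thesis using N0 by (simp add: spreadQ_def field_simps)
qed

sublocale step: kalman_analysis H Hadj \<beta> R \<epsilon> \<rho> b N "\<lambda>n. v j n - \<mu> j" "\<Sigma> j" for j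
  by unfold_locales (use rho R_norm R_sym eps N in \<open>auto simp: \<Sigma>_def outer_sum_def\<close>)

lemma S_step: "S (Suc j) \<le> spreadQ j + (1 + \<beta>) * (\<epsilon>\<^sup>2 * trR)"
proof -
  let ?U = "\<lambda>n. U (Suc j) n - emp_mean N (U (Suc j))"
  have "S (Suc j) = (1 / real (N - 1)) * (\<Sum>n<N. (norm (Q (?U n)))\<^sup>2)
     + (1 + \<beta>) * ((1 / real (N - 1)) * (\<Sum>n<N. (norm (H (?U n)))\<^sup>2))"
    by (simp add: S_def norm_T_sq_Q_H sum.distrib sum_distrib_left[symmetric] algebra_simps add_divide_distrib)
  also have "\<dots> \<le> spreadQ j + (1 + \<beta>) * (\<epsilon>\<^sup>2 * trR)"
    unfolding spreadQ_def trR_def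
    using beta by (intro add_mono mult_left_mono step.analysis_covariance[OF cov[of j]]) auto
  finally show ?thesis .
qed

text \<open>The induction starts after the first forecast, where truncation to the ball bounds the
  unobserved spread by \<open>r\<^sup>2\<close>. The spread of the Gaussian initial ensemble, which
  has no bound uniform over paths, never enters.\<close>

lemma S_bound: "S (Suc j) \<le> \<alpha> ^ j * r\<^sup>2 + (1 + \<beta>) * (\<epsilon>\<^sup>2 * trR) / (1 - \<alpha>)"
proof (induction j)
  case 0
  let ?B = "(1 + \<beta>) * (\<epsilon>\<^sup>2 * trR)"
  have B: "?B \<ge> 0" using beta trR_nonneg by simp
  have "?B * (1 - \<alpha>) \<le> ?B * 1" using B const by (intro mult_left_mono) auto
  then have "?B \<le> ?B / (1 - \<alpha>)" using const by (simp add: pos_le_divide_eq)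
  then show ?case using S_step[of 0] spreadQ_le_r[of 0] by simp
next
  case (Suc j)
  let ?B = "(1 + \<beta>) * (\<epsilon>\<^sup>2 * trR)"
  have "S (Suc (Suc j)) \<le> \<alpha> * S (Suc j) + ?B" using S_step[of "Suc j"] spreadQ_le[of "Suc j"] by simp
  also have "\<dots> \<le> \<alpha> * (\<alpha> ^ j * r\<^sup>2 + ?B / (1 - \<alpha>)) + ?B"
    using Suc const by (intro add_right_mono mult_left_mono) auto
  also have "\<dots> = \<alpha> ^ Suc j * r\<^sup>2 + ?B / (1 - \<alpha>)"
    using const by (simp add: field_simps)
  finally show ?case .
qed

text \<open>The projection fixes \<open>u j\<close> and is nonexpansive, so squeezing applies
  particle by particle. Averaging the distances costs \<open>sqrt (S j)\<close>, since the mean of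
  the images is not the image of the mean. The second bound is the diameter of the ball.\<close>

lemma Q_forecast:
  assumes u: "norm (u j) \<le> r"
  shows "norm (Q (\<mu> j - u (Suc j))) \<le> sqrt \<alpha> * (norm (T (emp_mean N (U j) - u j)) + sqrt (S j))"
    and "norm (Q (\<mu> j - u (Suc j))) \<le> 2 * r"
proof -
  have eq: "Q (\<mu> j - u (Suc j)) = emp_mean N (\<lambda>n. Q (w j n - u (Suc j)))"
    by (simp add: mu_eq Q.diff Q.add Q.scaleR Q_Hadj emp_mean_diff_const[OF N0(1)] emp_mean_linear[OF Q.linear_axioms])
  have u': "proj_BV r \<beta> (Hadj \<circ> H) (u j) = u j"
    using const(1) u by (intro proj_BV_ident) auto
  have each: "norm (Q (w j n - u (Suc j))) \<le> sqrt \<alpha> * norm (T (U j n - u j))" for n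
  proof (rule power2_le_imp_le)
    have "(norm (Q (w j n - u (Suc j))))\<^sup>2 \<le> \<alpha> * (norm (T (proj_BV r \<beta> (Hadj \<circ> H) (U j n) - u j)))\<^sup>2"
      unfolding w_def signal by (rule Psi_squeeze[OF proj_in u])
    also have "\<dots> \<le> \<alpha> * (norm (T (U j n - u j)))\<^sup>2"
      using proj_sq[of "U j n" "u j"] const by (intro mult_left_mono) (auto simp: u')
    finally show "(norm (Q (w j n - u (Suc j))))\<^sup>2 \<le> (sqrt \<alpha> * norm (T (U j n - u j)))\<^sup>2"
      using const by (simp add: power_mult_distrib)
  qed (use const in simp)
  have tri: "norm (T (U j n - u j)) \<le> norm (T (emp_mean N (U j) - u j)) + norm (T (U j n - emp_mean N (U j)))" for n
  proof -
    have "T (U j n - u j) = T (emp_mean N (U j) - u j) + T (U j n - emp_mean N (U j))" by (simp add: T.diff)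
    then show ?thesis by (metis norm_triangle_ineq)
  qed
  have "(1 / real N) * (\<Sum>n<N. norm (T (U j n - emp_mean N (U j))))
      \<le> sqrt ((1 / real N) * (\<Sum>n<N. (norm (T (U j n - emp_mean N (U j))))\<^sup>2))"
    by (rule emp_mean_norm_le_sqrt[OF N0(1)])
  also have "\<dots> \<le> sqrt (S j)"
    unfolding S_def using N by (intro real_sqrt_le_mono mult_right_mono divide_left_mono sum_nonneg) auto
  finally have sp: "(1 / real N) * (\<Sum>n<N. norm (T (U j n - emp_mean N (U j)))) \<le> sqrt (S j)" .
  have "norm (Q (\<mu> j - u (Suc j))) \<le> (1 / real N) * (\<Sum>n<N. norm (Q (w j n - u (Suc j))))"
    unfolding eq by (rule norm_emp_mean_le)
  also have "\<dots> \<le> (1 / real N) * (\<Sum>n<N. sqrt \<alpha> * (norm (T (emp_mean N (U j) - u j)) + norm (T (U j n - emp_mean N (U j)))))"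
    using const by (intro mult_left_mono sum_mono order_trans[OF each mult_left_mono[OF tri]]) auto
  also have "\<dots> = sqrt \<alpha> * (norm (T (emp_mean N (U j) - u j)) + (1 / real N) * (\<Sum>n<N. norm (T (U j n - emp_mean N (U j)))))"
    using N0 by (simp add: sum_distrib_left[symmetric] sum.distrib field_simps)
  also have "\<dots> \<le> sqrt \<alpha> * (norm (T (emp_mean N (U j) - u j)) + sqrt (S j))"
    using const sp by (intro mult_left_mono add_left_mono) auto
  finally show "norm (Q (\<mu> j - u (Suc j))) \<le> sqrt \<alpha> * (norm (T (emp_mean N (U j) - u j)) + sqrt (S j))" .
  have "norm (Q (\<mu> j - u (Suc j))) \<le> (1 / real N) * (\<Sum>n<N. norm (Q (w j n - u (Suc j))))"
    unfolding eq by (rule norm_emp_mean_le)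
  also have "\<dots> \<le> (1 / real N) * (\<Sum>n<N. 2 * r)"
  proof (intro mult_left_mono sum_mono)
    fix n
    have "norm (Q (w j n - u (Suc j))) \<le> norm (w j n - u (Suc j))" by (rule norm_Q_le)
    also have "\<dots> \<le> r + r"
      unfolding signal by (rule order_trans[OF norm_triangle_ineq4 add_mono[OF w_in Psi_in[OF u]]])
    finally show "norm (Q (w j n - u (Suc j))) \<le> 2 * r" by simp
  qed simp
  finally show "norm (Q (\<mu> j - u (Suc j))) \<le> 2 * r" using N0 by simp
qed

text \<open>Truncated forecasts and signal lie in the ball, so the bound on the innovation carries
  no trace of the previous error.\<close>

lemma H_forecast:
  assumes u: "norm (u j) \<le> r"
  shows "norm (H (\<mu> j - u (Suc j))) \<le> 2 * r + sqrt a * norm (emp_mean N (\<zeta> (Suc j)))"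
proof -
  have "norm (emp_mean N (w j)) \<le> (1 / real N) * (\<Sum>n<N. norm (w j n))" by (rule norm_emp_mean_le)
  also have "\<dots> \<le> (1 / real N) * (\<Sum>n<N. r)" by (intro mult_left_mono sum_mono w_in) simp
  finally have m: "norm (emp_mean N (w j)) \<le> r" using N0 by simp
  have "norm (emp_mean N (w j) - u (Suc j)) \<le> r + r"
    unfolding signal by (rule order_trans[OF norm_triangle_ineq4 add_mono[OF m Psi_in[OF u]]])
  then have "norm (H (emp_mean N (w j) - u (Suc j))) \<le> 2 * r"
    using norm_H_le[of "emp_mean N (w j) - u (Suc j)"] by simp
  moreover have "H (\<mu> j - u (Suc j)) = H (emp_mean N (w j) - u (Suc j)) + sqrt a *\<^sub>R emp_mean N (\<zeta> (Suc j))"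
    by (simp add: mu_eq H.diff H.add H.scaleR HHadj)
  ultimately show ?thesis
    using norm_triangle_ineq[of "H (emp_mean N (w j) - u (Suc j))" "sqrt a *\<^sub>R emp_mean N (\<zeta> (Suc j))"] a by simp
qed

text \<open>The term with \<open>S j\<close> is the drift of the forecast; once \<open>S j = O(\<epsilon>\<^sup>2)\<close> it is dominated by the
  contribution of \<open>\<epsilon>\<^sup>2 R\<close> to the innovation covariance.\<close>

lemma noise_form_le:
  "a * (\<Sum>n<N. (inner (\<zeta> (Suc j) n - emp_mean N (\<zeta> (Suc j))) x)\<^sup>2)
    \<le> 2 * real N * (inner (step.G j x) x + L * S j * (norm x)\<^sup>2)"
proof -
  let ?z = "\<lambda>n. \<zeta> (Suc j) n - emp_mean N (\<zeta> (Suc j))" and ?w = "\<lambda>n. w j n - emp_mean N (w j)"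
  have sq: "(p - q)\<^sup>2 \<le> 2 * (p\<^sup>2 + q\<^sup>2)" for p q :: real
    using sum_squares_bound[of p "- q"] by (simp add: power2_diff algebra_simps)
  have each: "a * (inner (?z n) x)\<^sup>2 \<le> 2 * ((inner (H (v j n - \<mu> j)) x)\<^sup>2 + (norm (T (?w n)))\<^sup>2 * (norm x)\<^sup>2)" for n
  proof -
    have "sqrt a * inner (?z n) x = inner (H (v j n - \<mu> j)) x - inner (H (?w n)) x"
      by (simp add: H_dev inner_add_left)
    then have "(sqrt a * inner (?z n) x)\<^sup>2 \<le> 2 * ((inner (H (v j n - \<mu> j)) x)\<^sup>2 + (inner (H (?w n)) x)\<^sup>2)"
      using sq by metis
    moreover have "(inner (H (?w n)) x)\<^sup>2 \<le> (norm (T (?w n)))\<^sup>2 * (norm x)\<^sup>2"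
    proof -
      have "\<bar>inner (H (?w n)) x\<bar> \<le> norm (H (?w n)) * norm x" by (rule Cauchy_Schwarz_ineq2)
      also have "\<dots> \<le> norm (T (?w n)) * norm x" by (intro mult_right_mono norm_H_le_T) auto
      finally have "\<bar>inner (H (?w n)) x\<bar>\<^sup>2 \<le> (norm (T (?w n)) * norm x)\<^sup>2" by (intro power_mono) auto
      then show ?thesis by (simp add: power_mult_distrib)
    qed
    ultimately show ?thesis using a by (simp add: power_mult_distrib)
  qed
  have W: "(\<Sum>n<N. (norm (T (?w n)))\<^sup>2) \<le> real N * (L * S j)"
  proof -
    have "(\<Sum>n<N. (norm (T (?w n)))\<^sup>2) = (\<Sum>n<N. (norm (T (w j n) - emp_mean N (\<lambda>n. T (w j n))))\<^sup>2)"
      by (simp add: emp_mean_linear[OF T.linear_axioms] T.diff)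
    also have "\<dots> \<le> L * (real (N - 1) * S j)"
      unfolding T_spread[symmetric]
      by (rule spread_contraction[OF N0(1)]) (use w_lip in \<open>simp add: T.diff\<close>)
    also have "\<dots> \<le> L * (real N * S j)"
      using const S_nonneg[of j] by (intro mult_left_mono mult_right_mono) auto
    finally show ?thesis by (simp add: ac_simps)
  qed
  have "a * (\<Sum>n<N. (inner (?z n) x)\<^sup>2)
      \<le> (\<Sum>n<N. 2 * ((inner (H (v j n - \<mu> j)) x)\<^sup>2 + (norm (T (?w n)))\<^sup>2 * (norm x)\<^sup>2))"
    unfolding sum_distrib_left by (rule sum_mono[OF each])
  also have "\<dots> = 2 * (real N * inner (step.G j x) x + (\<Sum>n<N. (norm (T (?w n)))\<^sup>2) * (norm x)\<^sup>2)"
    using N0 by (simp add: step.G_form sum_distrib_left[symmetric] sum_distrib_right[symmetric] sum.distrib)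
  also have "\<dots> \<le> 2 * (real N * inner (step.G j x) x + real N * (L * S j) * (norm x)\<^sup>2)"
    by (intro mult_left_mono add_left_mono mult_right_mono W) auto
  finally show ?thesis by (simp add: algebra_simps)
qed

text \<open>\<open>\<kappa>\<close> stays free because it is used twice: with the deterministic
  \<open>\<epsilon>\<^sup>2 * \<rho>\<close> and with a random bound from the inflation
  noise.\<close>

lemma error_step:
  assumes k: "\<kappa> > 0" "\<And>x. \<kappa> * (norm x)\<^sup>2 \<le> inner (step.S j x) x"
    and s: "s \<ge> 0" "spreadQ j \<le> s\<^sup>2" and u: "norm (u j) \<le> r"
  shows "norm (T (emp_mean N (U (Suc j)) - u (Suc j))) \<le> norm (Q (\<mu> j - u (Suc j)))
    + sqrt (1 + \<beta>) * (\<epsilon> * norm (\<eta> (Suc j)))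
    + (s + sqrt (1 + \<beta>) * (\<epsilon> * (b / sqrt \<rho>)))
      * ((\<epsilon> * norm (\<eta> (Suc j)) + (2 * r + sqrt a * norm (emp_mean N (\<zeta> (Suc j))))) / sqrt \<kappa>)"
proof -
  let ?y = "H (u (Suc j)) + \<epsilon> *\<^sub>R \<eta> (Suc j) - H (\<mu> j)"
  have y: "?y + H (\<mu> j - u (Suc j)) = \<epsilon> *\<^sub>R \<eta> (Suc j)" by (simp add: H.diff)
  have "?y = \<epsilon> *\<^sub>R \<eta> (Suc j) - H (\<mu> j - u (Suc j))" by (simp add: H.diff)
  then have "norm ?y \<le> norm (\<epsilon> *\<^sub>R \<eta> (Suc j)) + norm (H (\<mu> j - u (Suc j)))" by (metis norm_triangle_ineq4)
  then have ny: "norm ?y \<le> \<epsilon> * norm (\<eta> (Suc j)) + (2 * r + sqrt a * norm (emp_mean N (\<zeta> (Suc j))))"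
    using H_forecast[OF u] eps by simp
  have "(1 / real N) * (\<Sum>n<N. (norm (Q (v j n - \<mu> j)))\<^sup>2) \<le> s\<^sup>2" using s(2) by (simp add: spreadQ_def)
  from step.analysis_error[OF mean y k s(1) this]
  have "norm (T (emp_mean N (U (Suc j)) - u (Suc j))) \<le> norm (Q (\<mu> j - u (Suc j)))
      + sqrt (1 + \<beta>) * (\<epsilon> * norm (\<eta> (Suc j))) + (s + sqrt (1 + \<beta>) * (\<epsilon> * (b / sqrt \<rho>))) * (norm ?y / sqrt \<kappa>)" .
  also have "\<dots> \<le> norm (Q (\<mu> j - u (Suc j))) + sqrt (1 + \<beta>) * (\<epsilon> * norm (\<eta> (Suc j)))
    + (s + sqrt (1 + \<beta>) * (\<epsilon> * (b / sqrt \<rho>)))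
      * ((\<epsilon> * norm (\<eta> (Suc j)) + (2 * r + sqrt a * norm (emp_mean N (\<zeta> (Suc j))))) / sqrt \<kappa>)"
    using s(1) beta eps b_nonneg rho(1) k(1) ny by (intro add_left_mono mult_left_mono divide_right_mono) auto
  finally show ?thesis .
qed

lemma emp_noise_le: "(norm (emp_mean N (\<zeta> j)))\<^sup>2 \<le> (\<Sum>n<N. (norm (\<zeta> j n))\<^sup>2)"
proof -
  have "1 * (norm (emp_mean N (\<zeta> j)))\<^sup>2 \<le> real N * (norm (emp_mean N (\<zeta> j)))\<^sup>2"
    using N by (intro mult_right_mono) auto
  then show ?thesis using emp_mean_norm_sq_le[OF N0(1), of "\<zeta> j"] by linarith
qed

text \<open>The constants blow up as \<open>\<epsilon>\<close> tends to 0, but no error of the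
  preceding step occurs. This makes the expected error finite at one time, which is what the
  recursion needs to start.\<close>

lemma error_crude:
  assumes u: "norm (u j) \<le> r"
  defines "F \<equiv> (r + sqrt (1 + \<beta>) * (\<epsilon> * (b / sqrt \<rho>))) / (\<epsilon> * sqrt \<rho>)"
  shows "norm (T (emp_mean N (U (Suc j)) - u (Suc j)))
    \<le> (2 * r + sqrt (1 + \<beta>) * \<epsilon> + F * (\<epsilon> + 2 * r + sqrt a))
      + (sqrt (1 + \<beta>) * \<epsilon> + F * \<epsilon>) * (norm (\<eta> (Suc j)))\<^sup>2
      + F * sqrt a * (\<Sum>n<N. (norm (\<zeta> (Suc j) n))\<^sup>2)"
proof -
  have F0: "F \<ge> 0" unfolding F_def using const beta eps b_nonneg rho(1) by simp
  let ?e = "norm (\<eta> (Suc j))" and ?z = "norm (emp_mean N (\<zeta> (Suc j)))" and ?Z = "\<Sum>n<N. (norm (\<zeta> (Suc j) n))\<^sup>2"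
  have k: "\<epsilon>\<^sup>2 * \<rho> > 0" using eps rho(1) by simp
  have sk: "sqrt (\<epsilon>\<^sup>2 * \<rho>) = \<epsilon> * sqrt \<rho>" using eps by (simp add: real_sqrt_mult)
  have "norm (T (emp_mean N (U (Suc j)) - u (Suc j))) \<le> norm (Q (\<mu> j - u (Suc j)))
    + sqrt (1 + \<beta>) * (\<epsilon> * ?e) + (r + sqrt (1 + \<beta>) * (\<epsilon> * (b / sqrt \<rho>))) * ((\<epsilon> * ?e + (2 * r + sqrt a * ?z)) / sqrt (\<epsilon>\<^sup>2 * \<rho>))"
    using const by (intro error_step[OF k step.S_lower _ spreadQ_le_r u]) auto
  also have "\<dots> = norm (Q (\<mu> j - u (Suc j))) + sqrt (1 + \<beta>) * (\<epsilon> * ?e) + F * (\<epsilon> * ?e + (2 * r + sqrt a * ?z))"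
    by (simp add: F_def sk)
  also have "\<dots> \<le> 2 * r + sqrt (1 + \<beta>) * (\<epsilon> * (1 + ?e\<^sup>2)) + F * (\<epsilon> * (1 + ?e\<^sup>2) + (2 * r + sqrt a * (1 + ?Z)))"
  proof (intro add_mono mult_left_mono Q_forecast(2)[OF u] le_one_plus_sq order_refl)
    show "?z \<le> 1 + ?Z" using le_one_plus_sq[of ?z] emp_noise_le[of "Suc j"] by linarith
  qed (use eps beta F0 a in auto)
  also have "\<dots> = (2 * r + sqrt (1 + \<beta>) * \<epsilon> + F * (\<epsilon> + 2 * r + sqrt a))
      + (sqrt (1 + \<beta>) * \<epsilon> + F * \<epsilon>) * ?e\<^sup>2 + F * sqrt a * ?Z"
    by (simp add: algebra_simps)
  finally show ?thesis .
qed

text \<open>\<open>D\<close> collects the terms bounded by multiples of the innovation form: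
  \<open>1 / \<rho>\<close> for the floor \<open>\<epsilon>\<^sup>2\<close>, the rest for the Gram
  matrix, where \<open>L * c / \<rho>\<close> is the absorbed drift. \<open>B\<close> is the
  prefactor of the gain term divided by \<open>\<epsilon>\<close>. All four constants are free of
  \<open>\<epsilon>\<close>.\<close>

lemma error_fine:
  assumes u: "norm (u j) \<le> r" and c: "c \<ge> 0" "S j \<le> c * \<epsilon>\<^sup>2"
    and W: "W > 0" "\<And>x. (norm x)\<^sup>2 \<le> W * (\<epsilon>\<^sup>2 * (norm x)\<^sup>2
      + 2 * (real CARD('k))\<^sup>2 * (\<Sum>n<N. (inner (\<zeta> (Suc j) n - emp_mean N (\<zeta> (Suc j))) x)\<^sup>2))"
  defines "D \<equiv> 1 / \<rho> + 4 * (real CARD('k))\<^sup>2 * real N * (1 + L * c / \<rho>) / a"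
  defines "B \<equiv> sqrt (\<alpha> * c) + sqrt (1 + \<beta>) * (b / sqrt \<rho>)"
  defines "E1 \<equiv> sqrt (1 + \<beta>) + B / sqrt \<rho>" and "E2 \<equiv> B * sqrt D"
  shows "norm (T (emp_mean N (U (Suc j)) - u (Suc j)))
    \<le> sqrt \<alpha> * norm (T (emp_mean N (U j) - u j))
      + \<epsilon> * ((sqrt (\<alpha> * c) + E1 + 8 * r\<^sup>2 * E2) + E1 * (norm (\<eta> (Suc j)))\<^sup>2
         + 2 * a * E2 * (\<Sum>n<N. (norm (\<zeta> (Suc j) n))\<^sup>2) + E2 * W)"
proof -
  let ?e = "norm (\<eta> (Suc j))" and ?z = "norm (emp_mean N (\<zeta> (Suc j)))" and ?Z = "\<Sum>n<N. (norm (\<zeta> (Suc j) n))\<^sup>2"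
  let ?k = "(real CARD('k))\<^sup>2"
  have D0: "D > 0" unfolding D_def using rho(1) a c(1) const by (intro add_pos_nonneg) auto
  have B0: "B \<ge> 0" unfolding B_def using const c(1) beta b_nonneg rho(1) by simp
  \<comment> \<open>Two lower bounds at once: the random one serves the part of the innovation of
    order one, the deterministic one the part \<open>\<epsilon> * norm (\<eta> (Suc j))\<close>,
    where its \<open>1 / \<epsilon>\<close> cancels.\<close>
  define \<kappa> where "\<kappa> = max (1 / (W * D)) (\<epsilon>\<^sup>2 * \<rho>)"
  have WD: "W * D > 0" using W(1) D0 by simp
  have k0: "\<kappa> > 0" unfolding \<kappa>_def using WD by (simp add: less_max_iff_disj)
  have kS: "\<kappa> * (norm x)\<^sup>2 \<le> inner (step.S j x) x" for x
  proof -
    let ?F = "\<Sum>n<N. (inner (\<zeta> (Suc j) n - emp_mean N (\<zeta> (Suc j))) x)\<^sup>2"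
    let ?S = "inner (step.S j x) x"
    have S1: "\<epsilon>\<^sup>2 * \<rho> * (norm x)\<^sup>2 \<le> ?S" by (rule step.S_lower)
    then have e: "\<epsilon>\<^sup>2 * (norm x)\<^sup>2 \<le> ?S / \<rho>" using rho(1) by (simp add: pos_le_divide_eq ac_simps)
    have G: "inner (step.G j x) x \<le> ?S" using step.R_nonneg[of x] by (simp add: step.S_form)
    have "L * S j * (norm x)\<^sup>2 \<le> L * (c * \<epsilon>\<^sup>2) * (norm x)\<^sup>2"
      using c const by (intro mult_right_mono mult_left_mono) auto
    also have "\<dots> = L * c * (\<epsilon>\<^sup>2 * (norm x)\<^sup>2)" by (simp add: ac_simps)
    also have "\<dots> \<le> L * c * (?S / \<rho>)" using const c(1) by (intro mult_left_mono e) auto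
    finally have LS: "L * S j * (norm x)\<^sup>2 \<le> L * c * (?S / \<rho>)" .
    have "a * ?F \<le> 2 * real N * (inner (step.G j x) x + L * S j * (norm x)\<^sup>2)" by (rule noise_form_le)
    also have "\<dots> \<le> 2 * real N * (?S + L * c * (?S / \<rho>))"
      by (intro mult_left_mono add_mono G LS) auto
    finally have "?F \<le> 2 * real N * (?S + L * c * (?S / \<rho>)) / a" using a by (simp add: pos_le_divide_eq mult.commute)
    then have "2 * ?k * ?F \<le> 2 * ?k * (2 * real N * (?S + L * c * (?S / \<rho>)) / a)" by (intro mult_left_mono) auto
    then have "\<epsilon>\<^sup>2 * (norm x)\<^sup>2 + 2 * ?k * ?F \<le> ?S / \<rho> + 2 * ?k * (2 * real N * (?S + L * c * (?S / \<rho>)) / a)"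
      using e by (intro add_mono) auto
    also have "\<dots> = D * ?S" unfolding D_def by (simp add: algebra_simps add_divide_distrib)
    finally have "W * (\<epsilon>\<^sup>2 * (norm x)\<^sup>2 + 2 * ?k * ?F) \<le> W * (D * ?S)" using W(1) by (intro mult_left_mono) auto
    then have "(norm x)\<^sup>2 \<le> W * D * ?S" using W(2)[of x] by (simp add: mult.assoc)
    then have "1 / (W * D) * (norm x)\<^sup>2 \<le> ?S" using WD by (simp add: pos_divide_le_eq mult.commute)
    then show ?thesis using S1 by (auto simp: \<kappa>_def max_def)
  qed
  have k1: "1 / sqrt \<kappa> \<le> sqrt D * sqrt W"
  proof -
    have "sqrt (1 / (W * D)) \<le> sqrt \<kappa>" by (simp add: \<kappa>_def)
    then have "1 / sqrt \<kappa> \<le> 1 / sqrt (1 / (W * D))" using WD k0 by (intro divide_left_mono) auto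
    then show ?thesis using WD by (simp add: real_sqrt_divide real_sqrt_mult mult.commute)
  qed
  have k2: "1 / sqrt \<kappa> \<le> 1 / (\<epsilon> * sqrt \<rho>)"
  proof -
    have "sqrt (\<epsilon>\<^sup>2 * \<rho>) \<le> sqrt \<kappa>" by (simp add: \<kappa>_def)
    then have "\<epsilon> * sqrt \<rho> \<le> sqrt \<kappa>" using eps by (simp add: real_sqrt_mult)
    then show ?thesis using eps rho(1) k0 by (intro divide_left_mono) auto
  qed
  have Sq: "sqrt (S j) \<le> sqrt c * \<epsilon>"
    using real_sqrt_le_mono[OF c(2)] eps by (simp add: real_sqrt_mult)
  have s: "sqrt (\<alpha> * c) * \<epsilon> \<ge> 0" "spreadQ j \<le> (sqrt (\<alpha> * c) * \<epsilon>)\<^sup>2"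
  proof -
    have "\<alpha> * S j \<le> \<alpha> * (c * \<epsilon>\<^sup>2)" using c(2) const by (intro mult_left_mono) auto
    with spreadQ_le have "spreadQ j \<le> \<alpha> * (c * \<epsilon>\<^sup>2)" by (rule order_trans)
    then show "spreadQ j \<le> (sqrt (\<alpha> * c) * \<epsilon>)\<^sup>2" using const c(1) by (simp add: power_mult_distrib)
  qed (use const c(1) eps in simp)
  let ?zz = "2 * r + sqrt a * ?z"
  have zz0: "?zz \<ge> 0" using const a by simp
  \<comment> \<open>In the application \<open>?z\<close> and \<open>W\<close> come from the same
    noise, so their product is split before expectations are taken.\<close>
  have young: "?zz * sqrt W \<le> 8 * r\<^sup>2 + 2 * a * ?Z + W"
  proof -
    have "2 * (?zz * sqrt W) \<le> ?zz\<^sup>2 + (sqrt W)\<^sup>2" using sum_squares_bound[of ?zz "sqrt W"] by (simp only: mult.assoc)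
    moreover have "?zz\<^sup>2 \<le> 2 * ((2 * r)\<^sup>2 + (sqrt a * ?z)\<^sup>2)"
      using sum_squares_bound[of "2 * r" "sqrt a * ?z"] unfolding power2_sum mult_2[of "_ + _"] by linarith
    moreover have "(sqrt a * ?z)\<^sup>2 \<le> a * ?Z"
      using emp_noise_le[of "Suc j"] a by (simp add: power_mult_distrib)
    moreover have "0 \<le> ?zz * sqrt W" using zz0 W(1) by simp
    ultimately show ?thesis using W(1) by (simp add: power_mult_distrib)
  qed
  have quot: "(\<epsilon> * ?e + ?zz) / sqrt \<kappa> \<le> (1 + ?e\<^sup>2) / sqrt \<rho> + sqrt D * (8 * r\<^sup>2 + 2 * a * ?Z + W)"
  proof -
    have "(\<epsilon> * ?e + ?zz) / sqrt \<kappa> = (\<epsilon> * ?e) * (1 / sqrt \<kappa>) + ?zz * (1 / sqrt \<kappa>)"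
      by (simp add: add_divide_distrib)
    also have "\<dots> \<le> (\<epsilon> * ?e) * (1 / (\<epsilon> * sqrt \<rho>)) + ?zz * (sqrt D * sqrt W)"
      using eps zz0 by (intro add_mono mult_left_mono k1 k2) auto
    also have "\<dots> = ?e / sqrt \<rho> + sqrt D * (?zz * sqrt W)" using eps by (simp add: ac_simps)
    also have "\<dots> \<le> (1 + ?e\<^sup>2) / sqrt \<rho> + sqrt D * (8 * r\<^sup>2 + 2 * a * ?Z + W)"
      using rho(1) D0 by (intro add_mono divide_right_mono le_one_plus_sq mult_left_mono young) auto
    finally show ?thesis .
  qed
  have "norm (T (emp_mean N (U (Suc j)) - u (Suc j))) \<le> norm (Q (\<mu> j - u (Suc j)))
    + sqrt (1 + \<beta>) * (\<epsilon> * ?e)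
    + (sqrt (\<alpha> * c) * \<epsilon> + sqrt (1 + \<beta>) * (\<epsilon> * (b / sqrt \<rho>))) * ((\<epsilon> * ?e + ?zz) / sqrt \<kappa>)"
    by (rule error_step[OF k0 kS s u])
  also have "sqrt (\<alpha> * c) * \<epsilon> + sqrt (1 + \<beta>) * (\<epsilon> * (b / sqrt \<rho>)) = \<epsilon> * B" by (simp add: B_def algebra_simps)
  also have "norm (Q (\<mu> j - u (Suc j))) + sqrt (1 + \<beta>) * (\<epsilon> * ?e) + \<epsilon> * B * ((\<epsilon> * ?e + ?zz) / sqrt \<kappa>)
    \<le> sqrt \<alpha> * (norm (T (emp_mean N (U j) - u j)) + sqrt c * \<epsilon>) + sqrt (1 + \<beta>) * (\<epsilon> * (1 + ?e\<^sup>2))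
      + \<epsilon> * B * ((1 + ?e\<^sup>2) / sqrt \<rho> + sqrt D * (8 * r\<^sup>2 + 2 * a * ?Z + W))"
  proof (intro add_mono)
    show "norm (Q (\<mu> j - u (Suc j))) \<le> sqrt \<alpha> * (norm (T (emp_mean N (U j) - u j)) + sqrt c * \<epsilon>)"
      using const by (intro order_trans[OF Q_forecast(1)[OF u]] mult_left_mono add_left_mono Sq) auto
    show "sqrt (1 + \<beta>) * (\<epsilon> * ?e) \<le> sqrt (1 + \<beta>) * (\<epsilon> * (1 + ?e\<^sup>2))"
      using eps beta by (intro mult_left_mono le_one_plus_sq) auto
    show "\<epsilon> * B * ((\<epsilon> * ?e + ?zz) / sqrt \<kappa>) \<le> \<epsilon> * B * ((1 + ?e\<^sup>2) / sqrt \<rho> + sqrt D * (8 * r\<^sup>2 + 2 * a * ?Z + W))"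
      using eps B0 by (intro mult_left_mono quot) auto
  qed
  also have "\<dots> = sqrt \<alpha> * norm (T (emp_mean N (U j) - u j))
      + \<epsilon> * ((sqrt (\<alpha> * c) + E1 + 8 * r\<^sup>2 * E2) + E1 * ?e\<^sup>2 + 2 * a * E2 * ?Z + E2 * W)"
    by (simp add: E1_def E2_def real_sqrt_mult algebra_simps add_divide_distrib)
  finally show ?thesis .
qed

end

section \<open>Expectations and the accuracy theorem\<close>

text \<open>In \<open>ennreal\<close> the recursion says nothing from an infinite value, hence the
  finite bound \<open>x\<close> at some \<open>J\<close>. Its contribution decays like
  \<open>s ^ n\<close> and leaves no trace in the limit.\<close>

lemma limsup_affine_recursion:
  fixes e :: "nat \<Rightarrow> ennreal" and s c x :: real
  assumes s: "0 \<le> s" "s < 1" and c: "0 \<le> c" and x: "0 \<le> x" "e J \<le> ennreal x"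
    and rec: "\<And>j. J \<le> j \<Longrightarrow> e (Suc j) \<le> ennreal s * e j + ennreal c"
  shows "limsup e \<le> ennreal (c / (1 - s))"
proof -
  have b: "e (J + n) \<le> ennreal (s ^ n * x + c / (1 - s))" for n
  proof (induction n)
    case 0
    then show ?case using x s c by (auto intro: order_trans ennreal_leI)
  next
    case (Suc n)
    have "e (J + Suc n) \<le> ennreal s * e (J + n) + ennreal c" using rec[of "J + n"] by simp
    also have "\<dots> \<le> ennreal s * ennreal (s ^ n * x + c / (1 - s)) + ennreal c"
      by (intro add_right_mono mult_left_mono Suc) simp
    also have "\<dots> = ennreal (s * (s ^ n * x + c / (1 - s)) + c)"
      using s c x by (simp add: ennreal_mult ennreal_plus)
    also have "s * (s ^ n * x + c / (1 - s)) + c = s ^ Suc n * x + c / (1 - s)"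
      using s by (simp add: field_simps)
    finally show ?case .
  qed
  have "limsup e = limsup (\<lambda>n. e (n + J))" by (rule limsup_shift_k[symmetric])
  also have "\<dots> \<le> limsup (\<lambda>n. ennreal (s ^ n * x + c / (1 - s)))"
    using b by (intro Limsup_mono always_eventually) (simp add: add.commute)
  also have "\<dots> = ennreal (c / (1 - s))"
  proof (rule lim_imp_Limsup)
    have "(\<lambda>n. s ^ n * x + c / (1 - s)) \<longlonglongrightarrow> 0 * x + c / (1 - s)"
      using s by (intro tendsto_intros LIMSEQ_realpow_zero) auto
    then show "(\<lambda>n. ennreal (s ^ n * x + c / (1 - s))) \<longlonglongrightarrow> ennreal (c / (1 - s))"
      by (intro tendsto_ennrealI) simp
  qed simp
  finally show ?thesis .
qed

section \<open>Moments and independence of the noises\<close>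

context prob_space
begin

lemma nn_integral_gaussian_norm_sq:
  fixes X :: "'a \<Rightarrow> real^'n"
  assumes X: "gaussian_rv M X 0 id"
  shows "(\<integral>\<^sup>+\<omega>. ennreal ((norm (X \<omega>))\<^sup>2) \<partial>M) = ennreal (real CARD('n))"
proof -
  have [measurable]: "X \<in> borel_measurable M" using X by (simp add: gaussian_rv_def)
  have one: "(\<integral>\<^sup>+x. ennreal (x\<^sup>2) \<partial>density lborel (normal_density 0 1)) = 1"
  proof -
    have hb: "has_bochner_integral lborel (\<lambda>x. normal_density 0 1 x * x\<^sup>2) 1"
      using std_normal_moment_even[of 1] by simp
    have "(\<integral>\<^sup>+x. ennreal (x\<^sup>2) \<partial>density lborel (normal_density 0 1))
        = (\<integral>\<^sup>+x. ennreal (normal_density 0 1 x * x\<^sup>2) \<partial>lborel)"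
      by (subst nn_integral_density) (auto simp: ennreal_mult)
    also have "\<dots> = ennreal 1"
      using hb by (subst nn_integral_eq_integral) (auto simp: has_bochner_integral_iff)
    finally show ?thesis by simp
  qed
  have sq: "(norm x)\<^sup>2 = (\<Sum>p\<in>UNIV. (inner x (axis p 1))\<^sup>2)" for x :: "real^'n"
    unfolding power2_norm_eq_inner inner_vec_def by (simp add: power2_eq_square axis_def if_distrib cong: if_cong)
  have "(\<integral>\<^sup>+\<omega>. ennreal ((norm (X \<omega>))\<^sup>2) \<partial>M)
      = (\<integral>\<^sup>+\<omega>. (\<Sum>p\<in>UNIV. ennreal ((inner (X \<omega>) (axis p 1))\<^sup>2)) \<partial>M)"
    by (simp add: sq)
  also have "\<dots> = (\<Sum>p\<in>UNIV. \<integral>\<^sup>+\<omega>. ennreal ((inner (X \<omega>) (axis p 1))\<^sup>2) \<partial>M)"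
    by (intro nn_integral_sum) auto
  also have "\<dots> = (\<Sum>p\<in>(UNIV :: 'n set). 1)"
  proof (rule sum.cong[OF refl])
    fix p :: 'n
    have "(\<integral>\<^sup>+\<omega>. ennreal ((inner (X \<omega>) (axis p 1))\<^sup>2) \<partial>M)
        = (\<integral>\<^sup>+t. ennreal (t\<^sup>2) \<partial>distr M borel (\<lambda>\<omega>. inner (X \<omega>) (axis p 1)))"
      by (simp add: nn_integral_distr)
    also have "\<dots> = 1" by (simp add: gaussian_rv_unit_distr[OF X] one)
    finally show "(\<integral>\<^sup>+\<omega>. ennreal ((inner (X \<omega>) (axis p 1))\<^sup>2) \<partial>M) = 1" .
  qed
  finally show ?thesis by (simp add: ennreal_of_nat_eq_real_of_nat)
qed

lemma nn_integral_affine_le: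
  fixes f g h :: "'a \<Rightarrow> real"
  assumes m [measurable]: "f \<in> borel_measurable M" "g \<in> borel_measurable M" "h \<in> borel_measurable M"
    and nn: "\<And>\<omega>. 0 \<le> f \<omega>" "\<And>\<omega>. 0 \<le> g \<omega>" "\<And>\<omega>. 0 \<le> h \<omega>"
    and int: "(\<integral>\<^sup>+\<omega>. ennreal (f \<omega>) \<partial>M) \<le> ennreal F" "(\<integral>\<^sup>+\<omega>. ennreal (g \<omega>) \<partial>M) \<le> ennreal G"
      "(\<integral>\<^sup>+\<omega>. ennreal (h \<omega>) \<partial>M) \<le> ennreal K"
    and p: "0 \<le> p0" "0 \<le> p1" "0 \<le> p2" "0 \<le> p3" and F: "0 \<le> F" "0 \<le> G" "0 \<le> K"
  shows "(\<integral>\<^sup>+\<omega>. ennreal (p0 + p1 * f \<omega> + p2 * g \<omega> + p3 * h \<omega>) \<partial>M) \<le> ennreal (p0 + p1 * F + p2 * G + p3 * K)"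
proof -
  have "(\<integral>\<^sup>+\<omega>. ennreal (p0 + p1 * f \<omega> + p2 * g \<omega> + p3 * h \<omega>) \<partial>M)
     = (\<integral>\<^sup>+\<omega>. ennreal p0 + ennreal p1 * ennreal (f \<omega>) + ennreal p2 * ennreal (g \<omega>) + ennreal p3 * ennreal (h \<omega>) \<partial>M)"
    using p nn by (simp add: ennreal_plus ennreal_mult)
  also have "\<dots> = ennreal p0 + ennreal p1 * (\<integral>\<^sup>+\<omega>. ennreal (f \<omega>) \<partial>M) + ennreal p2 * (\<integral>\<^sup>+\<omega>. ennreal (g \<omega>) \<partial>M)
      + ennreal p3 * (\<integral>\<^sup>+\<omega>. ennreal (h \<omega>) \<partial>M)"
    by (simp add: nn_integral_add nn_integral_cmult emeasure_space_1)
  also have "\<dots> \<le> ennreal p0 + ennreal p1 * ennreal F + ennreal p2 * ennreal G + ennreal p3 * ennreal K"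
    by (intro add_mono mult_left_mono int) auto
  also have "\<dots> = ennreal (p0 + p1 * F + p2 * G + p3 * K)"
    using p F by (simp add: ennreal_plus ennreal_mult)
  finally show ?thesis .
qed

lemma indep_inflation:
  fixes \<zeta> :: "nat \<Rightarrow> nat \<Rightarrow> 'a \<Rightarrow> real^'k" and U0 :: "nat \<Rightarrow> 'a \<Rightarrow> 'h::topological_space"
  assumes indep: "indep_sets (enkf_sigma M U0 \<zeta> \<eta>) (enkf_index N)" and j: "1 \<le> j"
    and m: "\<And>n. n < N \<Longrightarrow> \<zeta> j n \<in> borel_measurable M"
  shows "indep_vars (\<lambda>_. borel) (\<zeta> j) {..<N}"
  unfolding indep_vars_def2
proof (intro conjI ballI)
  show "\<zeta> j n \<in> borel_measurable M" if "n \<in> {..<N}" for n using m that by simp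
  let ?E = "\<lambda>n. {\<zeta> j n -` A \<inter> space M |A. A \<in> sets borel}"
  show "indep_sets ?E {..<N}"
    unfolding indep_sets_def
  proof (intro conjI ballI allI impI)
    show "?E n \<subseteq> events" if "n \<in> {..<N}" for n
      using m[of n] that by (auto simp: measurable_sets)
    fix J A assume J: "J \<subseteq> {..<N}" "J \<noteq> {}" "finite J" and A: "A \<in> Pi J ?E"
    \<comment> \<open>Independence is given for the family indexed by sources; \<open>B\<close>
      moves the event of particle \<open>n\<close> to the source \<open>Infl j n\<close>. The other
      two cases lie outside the index set used.\<close>
    define B where "B s = (case s of Init n \<Rightarrow> A n | Infl i n \<Rightarrow> A n | Obs n \<Rightarrow> A n)" for s
    have inj: "inj_on (Infl j) J" by (auto simp: inj_on_def)
    have sub: "Infl j ` J \<subseteq> enkf_index N" using J(1) j by (auto simp: enkf_index_def)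
    have "B \<in> Pi (Infl j ` J) (enkf_sigma M U0 \<zeta> \<eta>)"
      using A by (auto simp: B_def enkf_sigma_def Pi_iff)
    then have "prob (\<Inter>s\<in>Infl j ` J. B s) = (\<Prod>s\<in>Infl j ` J. prob (B s))"
      using indep J(2,3) sub unfolding indep_sets_def by blast
    then show "prob (\<Inter>n\<in>J. A n) = (\<Prod>n\<in>J. prob (A n))"
      by (simp add: prod.reindex[OF inj] B_def image_image)
  qed
qed

section \<open>Covariance of the observation noise\<close>

lemma covariance_form:
  fixes \<eta> :: "'a \<Rightarrow> real^'k" and R :: "real^'k^'k"
  assumes R: "\<And>p q. integrable M (\<lambda>\<omega>. \<eta> \<omega> $ p * \<eta> \<omega> $ q)"
    "\<And>p q. (\<integral>\<omega>. \<eta> \<omega> $ p * \<eta> \<omega> $ q \<partial>M) = R $ p $ q"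
  shows "integrable M (\<lambda>\<omega>. inner (\<eta> \<omega>) x * inner (\<eta> \<omega>) y)"
    and "inner (R *v x) y = (\<integral>\<omega>. inner (\<eta> \<omega>) x * inner (\<eta> \<omega>) y \<partial>M)"
proof -
  have eq: "inner (\<eta> \<omega>) x * inner (\<eta> \<omega>) y = (\<Sum>p\<in>UNIV. \<Sum>q\<in>UNIV. (x $ q * y $ p) * (\<eta> \<omega> $ p * \<eta> \<omega> $ q))" for \<omega>
    by (simp add: inner_vec_def sum_product) (subst sum.swap, simp add: ac_simps)
  show "integrable M (\<lambda>\<omega>. inner (\<eta> \<omega>) x * inner (\<eta> \<omega>) y)"
    unfolding eq using R(1) by (intro Bochner_Integration.integrable_sum integrable_mult_right) auto
  have "(\<integral>\<omega>. inner (\<eta> \<omega>) x * inner (\<eta> \<omega>) y \<partial>M) = (\<Sum>p\<in>UNIV. \<Sum>q\<in>UNIV. (x $ q * y $ p) * R $ p $ q)"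
    unfolding eq using R by (simp add: Bochner_Integration.integral_sum)
  also have "\<dots> = inner (R *v x) y"
    by (simp add: inner_vec_def matrix_vector_mult_def sum_distrib_right sum_distrib_left ac_simps)
  finally show "inner (R *v x) y = (\<integral>\<omega>. inner (\<eta> \<omega>) x * inner (\<eta> \<omega>) y \<partial>M)" ..
qed

lemma covariance_symmetric:
  fixes \<eta> :: "'a \<Rightarrow> real^'k" and R :: "real^'k^'k"
  assumes R: "\<And>p q. integrable M (\<lambda>\<omega>. \<eta> \<omega> $ p * \<eta> \<omega> $ q)"
    "\<And>p q. (\<integral>\<omega>. \<eta> \<omega> $ p * \<eta> \<omega> $ q \<partial>M) = R $ p $ q"
  shows "inner (R *v x) y = inner x (R *v y)"
  using covariance_form(2)[OF R, of x y] covariance_form(2)[OF R, of y x]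
  by (simp add: mult.commute inner_commute[of x])

text \<open>If the form vanishes at \<open>x\<close> then \<open>inner (\<eta> \<omega>) x\<close>
  vanishes almost surely, hence \<open>R *v x = 0\<close>, against invertibility. Compactness of the
  unit sphere turns strict positivity into a uniform bound.\<close>

lemma covariance_coercive:
  fixes \<eta> :: "'a \<Rightarrow> real^'k" and R :: "real^'k^'k"
  assumes R: "\<And>p q. integrable M (\<lambda>\<omega>. \<eta> \<omega> $ p * \<eta> \<omega> $ q)"
    "\<And>p q. (\<integral>\<omega>. \<eta> \<omega> $ p * \<eta> \<omega> $ q \<partial>M) = R $ p $ q" and inv: "invertible R"
  obtains \<rho> where "\<rho> > 0" "\<And>x. \<rho> * (norm x)\<^sup>2 \<le> inner (R *v x) x"
proof -
  have pos: "inner (R *v x) x > 0" if "x \<noteq> 0" for x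
  proof (rule ccontr)
    assume "\<not> ?thesis"
    moreover have form: "inner (R *v x) x = (\<integral>\<omega>. inner (\<eta> \<omega>) x * inner (\<eta> \<omega>) x \<partial>M)" by (rule covariance_form(2)[OF R])
    moreover have "0 \<le> (\<integral>\<omega>. inner (\<eta> \<omega>) x * inner (\<eta> \<omega>) x \<partial>M)" by (rule Bochner_Integration.integral_nonneg) simp
    ultimately have "(\<integral>\<omega>. inner (\<eta> \<omega>) x * inner (\<eta> \<omega>) x \<partial>M) = 0" by simp
    then have ae: "AE \<omega> in M. inner (\<eta> \<omega>) x = 0"
      by (subst (asm) integral_nonneg_eq_0_iff_AE[OF covariance_form(1)[OF R]]) auto
    have "inner (R *v x) y = 0" for y
    proof -
      have "inner (R *v x) y = (\<integral>\<omega>. inner (\<eta> \<omega>) x * inner (\<eta> \<omega>) y \<partial>M)" by (rule covariance_form(2)[OF R])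
      also have "\<dots> = 0" using ae by (intro integral_eq_zero_AE) auto
      finally show ?thesis .
    qed
    then have "R *v x = 0" by (metis inner_eq_zero_iff)
    moreover have "inj ((*v) R)"
      using inv by (simp add: invertible_left_inverse matrix_left_invertible_injective)
    ultimately have "x = 0" by (metis injD matrix_vector_mult_0_right)
    then show False using that by simp
  qed
  have "continuous_on (sphere 0 1) (\<lambda>x. inner (R *v x) x)"
    by (intro continuous_intros matrix_vector_mult_linear_continuous_on)
  moreover have "sphere 0 1 \<noteq> ({} :: (real^'k) set)" by simp
  ultimately have "\<exists>x0\<in>sphere 0 1. \<forall>x\<in>sphere 0 1. inner (R *v x0) x0 \<le> inner (R *v x) x"
    by (intro continuous_attains_inf compact_sphere)
  then obtain x0 where x0: "x0 \<in> sphere 0 1" "\<And>x. x \<in> sphere 0 1 \<Longrightarrow> inner (R *v x0) x0 \<le> inner (R *v x) x"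
    by blast
  show ?thesis
  proof (rule that)
    show "inner (R *v x0) x0 > 0" using x0(1) by (intro pos) auto
    show "inner (R *v x0) x0 * (norm x)\<^sup>2 \<le> inner (R *v x) x" for x
    proof (cases "x = 0")
      case False
      let ?y = "x /\<^sub>R norm x"
      have "inner (R *v x0) x0 \<le> inner (R *v ?y) ?y" using False by (intro x0(2)) simp
      also have "\<dots> = inner (R *v x) x / (norm x)\<^sup>2"
        by (simp add: matrix_vector_mult_scaleR power2_eq_square divide_inverse)
      finally show ?thesis using False by (simp add: pos_le_divide_eq)
    qed simp
  qed
qed

lemma nn_integral_norm_sq_covariance:
  fixes \<eta> :: "'a \<Rightarrow> real^'k" and R :: "real^'k^'k"
  assumes R: "\<And>p q. integrable M (\<lambda>\<omega>. \<eta> \<omega> $ p * \<eta> \<omega> $ q)"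
    "\<And>p q. (\<integral>\<omega>. \<eta> \<omega> $ p * \<eta> \<omega> $ q \<partial>M) = R $ p $ q"
  shows "(\<integral>\<^sup>+\<omega>. ennreal ((norm (\<eta> \<omega>))\<^sup>2) \<partial>M) = ennreal (\<Sum>i\<in>UNIV. R $ i $ i)"
proof -
  have sq: "(norm x)\<^sup>2 = (\<Sum>p\<in>UNIV. x $ p * x $ p)" for x :: "real^'k"
    unfolding power2_norm_eq_inner inner_vec_def by simp
  have "(\<integral>\<^sup>+\<omega>. ennreal ((norm (\<eta> \<omega>))\<^sup>2) \<partial>M) = ennreal (\<integral>\<omega>. (\<Sum>p\<in>UNIV. \<eta> \<omega> $ p * \<eta> \<omega> $ p) \<partial>M)"
    unfolding sq using R(1) by (intro nn_integral_eq_integral Bochner_Integration.integrable_sum) (auto intro!: sum_nonneg)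
  also have "\<dots> = ennreal (\<Sum>i\<in>UNIV. R $ i $ i)"
    using R by (simp add: Bochner_Integration.integral_sum)
  finally show ?thesis .
qed

end

section \<open>Constants uniform in the noise level and the limit in time\<close>

theorem theorem2p2:
  fixes \<Psi> :: "'h::{real_inner, complete_space, second_countable_topology} \<Rightarrow> 'h"
    and H :: "'h \<Rightarrow> real^'k" and Hadj :: "real^'k \<Rightarrow> 'h"
    and R :: "real^'k^'k"
    and u0 m0 :: 'h and C0 :: "'h \<Rightarrow> 'h"
    and r \<beta> L \<alpha> :: real and N :: nat
    and M :: "'a measure"
    and U0 :: "nat \<Rightarrow> 'a \<Rightarrow> 'h"
    and \<zeta> :: "nat \<Rightarrow> nat \<Rightarrow> 'a \<Rightarrow> real^'k"
    and \<eta> :: "nat \<Rightarrow> 'a \<Rightarrow> real^'k"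
  assumes H_lin: "bounded_linear H"
    and H_adj: "\<forall>u z. inner (H u) z = inner u (Hadj z)"
    and HHadj: "\<forall>z. H (Hadj z) = z"
    and A: "assumption_A \<Psi> (Hadj \<circ> H) r \<beta> L \<alpha>"
    and N_large: "real N \<ge> 6 * real CARD('k)"
    and prob: "prob_space M"
    and init: "\<forall>n<N. gaussian_rv M (U0 n) m0 C0"
    and infl: "\<forall>j\<ge>1. \<forall>n<N. gaussian_rv M (\<zeta> j n) 0 id"
    and obs: "\<forall>j\<ge>1. \<eta> j \<in> borel_measurable M \<and> integrable M (\<eta> j) \<and>
                 integral\<^sup>L M (\<eta> j) = 0 \<and>
                 (\<forall>p q. integrable M (\<lambda>\<omega>. \<eta> j \<omega> $ p * \<eta> j \<omega> $ q) \<and>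
                        (\<integral>\<omega>. \<eta> j \<omega> $ p * \<eta> j \<omega> $ q \<partial>M) = R $ p $ q)"
    and R_inv: "invertible R"
    and indep: "prob_space.indep_sets M (enkf_sigma M U0 \<zeta> \<eta>) (enkf_index N)"
  shows "\<exists>a0>0. \<forall>a\<ge>a0. \<exists>C. \<forall>\<epsilon>>0. \<forall>U.
           enkf_run \<Psi> H Hadj R r \<beta> N a \<epsilon> M U0 \<zeta>
             (\<lambda>j \<omega>. H ((\<Psi> ^^ j) u0) + \<epsilon> *\<^sub>R \<eta> j \<omega>) U \<longrightarrow>
           limsup (\<lambda>j. \<integral>\<^sup>+ \<omega>. ennreal (norm (emp_mean N (\<lambda>n. U j n \<omega>) - (\<Psi> ^^ j) u0)) \<partial>M)
             \<le> ennreal (C * \<epsilon>)"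
proof -
  interpret prob_space M by (rule prob)
  from A have par: "r > 0" "\<beta> \<ge> 0" "L > 0" "0 < \<alpha>" "\<alpha> < 1" by (auto simp: assumption_A_def)
  interpret wo: weighted_observation H Hadj \<beta>
    by (rule weighted_observation.intro) (use H_lin H_adj HHadj par in auto)
  let ?u = "\<lambda>j. (\<Psi> ^^ j) u0"
  let ?k = "real CARD('k)"
  have R: "integrable M (\<lambda>\<omega>. \<eta> j \<omega> $ p * \<eta> j \<omega> $ q)" "(\<integral>\<omega>. \<eta> j \<omega> $ p * \<eta> j \<omega> $ q \<partial>M) = R $ p $ q"
    if "1 \<le> j" for j p q using obs that by auto
  have etam: "\<eta> j \<in> borel_measurable M" if "1 \<le> j" for j using obs that by auto
  have zetam: "\<zeta> j n \<in> borel_measurable M" if "1 \<le> j" "n < N" for j n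
    using infl that by (auto simp: gaussian_rv_def)
  obtain \<rho> where rho: "\<rho> > 0" "\<And>x. \<rho> * (norm x)\<^sup>2 \<le> inner (R *v x) x"
    using covariance_coercive[OF R R_inv] by blast
  have R_sym: "inner (R *v x) y = inner x (R *v y)" for x y
    by (rule covariance_symmetric[OF R]) auto
  define b where "b = onorm ((*v) R)"
  have R_norm: "norm (R *v x) \<le> b * norm x" for x
    unfolding b_def by (rule onorm) (rule matrix_vector_mul_bounded_linear)
  have b0: "b \<ge> 0" unfolding b_def by (rule onorm_pos_le) (rule matrix_vector_mul_bounded_linear)
  have k1: "?k \<ge> 1" by simp
  then have N6: "real N \<ge> 6" using N_large by linarith
  then have N2: "N \<ge> 2" by linarith
  have N6k: "6 * CARD('k) \<le> N" using N_large by (metis of_nat_le_iff of_nat_mult of_nat_numeral)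
  define tr where "tr = (\<Sum>i\<in>UNIV. R $ i $ i)"
  obtain T0 where T0: "\<And>j. j \<ge> T0 \<Longrightarrow> norm (?u j) \<le> r"
  proof -
    have "\<exists>T. \<forall>n\<ge>T. (\<Psi> ^^ n) ` {u0} \<subseteq> cball 0 r"
      using A unfolding assumption_A_def absorbing_forward_invariant_def by (meson bounded_insert bounded_empty)
    then show ?thesis using that by auto
  qed
  have E_eta: "(\<integral>\<^sup>+\<omega>. ennreal ((norm (\<eta> j \<omega>))\<^sup>2) \<partial>M) \<le> ennreal tr" if "1 \<le> j" for j
    unfolding tr_def by (rule eq_refl[OF nn_integral_norm_sq_covariance[OF R]]) (rule that)+
  have tr0: "tr \<ge> 0"
    unfolding tr_def
  proof (rule sum_nonneg)
    fix i
    have "0 \<le> (\<integral>\<omega>. \<eta> 1 \<omega> $ i * \<eta> 1 \<omega> $ i \<partial>M)" by (rule Bochner_Integration.integral_nonneg) simp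
    then show "0 \<le> R $ i $ i" unfolding R(2)[OF order_refl] .
  qed
  have E_zeta: "(\<integral>\<^sup>+\<omega>. ennreal (\<Sum>n<N. (norm (\<zeta> j n \<omega>))\<^sup>2) \<partial>M) \<le> ennreal (real N * ?k)" if j: "1 \<le> j" for j
  proof -
    have "(\<integral>\<^sup>+\<omega>. ennreal (\<Sum>n<N. (norm (\<zeta> j n \<omega>))\<^sup>2) \<partial>M) = (\<integral>\<^sup>+\<omega>. (\<Sum>n<N. ennreal ((norm (\<zeta> j n \<omega>))\<^sup>2)) \<partial>M)"
      by simp
    also have "\<dots> = (\<Sum>n<N. \<integral>\<^sup>+\<omega>. ennreal ((norm (\<zeta> j n \<omega>))\<^sup>2) \<partial>M)"
      using zetam[OF j] by (intro nn_integral_sum) auto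
    also have "\<dots> = (\<Sum>n<N. ennreal ?k)"
      using infl j by (intro sum.cong refl nn_integral_gaussian_norm_sq) auto
    also have "\<dots> = ennreal (real N * ?k)"
      by (simp add: ennreal_mult' ennreal_of_nat_eq_real_of_nat)
    finally show ?thesis by simp
  qed
  have Zm: "(\<lambda>\<omega>. \<Sum>n<N. (norm (\<zeta> j n \<omega>))\<^sup>2) \<in> borel_measurable M" if "1 \<le> j" for j
    using zetam[OF that] by (intro borel_measurable_sum) auto
  have em: "(\<lambda>\<omega>. (norm (\<eta> j \<omega>))\<^sup>2) \<in> borel_measurable M" if "1 \<le> j" for j
    using etam[OF that] by auto
  show ?thesis
  \<comment> \<open>The estimates use \<open>a > 0\<close> and constants that may depend on
    \<open>a\<close>, so 1 is a convenient threshold.\<close>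
  proof (rule exI[of _ 1], intro conjI allI impI)
    fix a :: real assume "1 \<le> a"
    then have a: "a > 0" by simp
    \<comment> \<open>The second summand is the stationary level of the spread recursion divided by
      \<open>\<epsilon>\<^sup>2\<close>; the 1 makes room for the geometric transient once it has
      fallen below \<open>\<epsilon>\<^sup>2\<close>.\<close>
    define c where "c = 1 + (1 + \<beta>) * tr / (1 - \<alpha>)"
    define D where "D = 1 / \<rho> + 4 * ?k\<^sup>2 * real N * (1 + L * c / \<rho>) / a"
    define B where "B = sqrt (\<alpha> * c) + sqrt (1 + \<beta>) * (b / sqrt \<rho>)"
    define E1 where "E1 = sqrt (1 + \<beta>) + B / sqrt \<rho>"
    define E2 where "E2 = B * sqrt D"
    \<comment> \<open>Bounds the expected noise term of \<open>error_fine\<close>: \<open>tr\<close>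
      and \<open>real N * ?k\<close> are the second moments of the noises,
      \<open>(7 * ?k) ^ 3\<close> the bound on the mean of \<open>W\<close>.\<close>
    define C1 where "C1 = (sqrt (\<alpha> * c) + E1 + 8 * r\<^sup>2 * E2) + E1 * tr + 2 * a * E2 * (real N * ?k) + E2 * (7 * ?k) ^ 3"
    have c0: "c \<ge> 0" unfolding c_def using par tr0 by simp
    have D0: "D \<ge> 0" unfolding D_def using rho(1) a c0 par by simp
    have B0: "B \<ge> 0" unfolding B_def using par c0 b0 rho(1) by simp
    have E0: "E1 \<ge> 0" "E2 \<ge> 0" unfolding E1_def E2_def using B0 D0 par rho(1) by auto
    have C10: "C1 \<ge> 0" unfolding C1_def using par c0 E0 tr0 a by simp
    have s: "0 \<le> sqrt \<alpha>" "sqrt \<alpha> < 1" using par by auto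
    show "\<exists>C. \<forall>\<epsilon>>0. \<forall>U. enkf_run \<Psi> H Hadj R r \<beta> N a \<epsilon> M U0 \<zeta> (\<lambda>j \<omega>. H (?u j) + \<epsilon> *\<^sub>R \<eta> j \<omega>) U \<longrightarrow>
       limsup (\<lambda>j. \<integral>\<^sup>+ \<omega>. ennreal (norm (emp_mean N (\<lambda>n. U j n \<omega>) - ?u j)) \<partial>M) \<le> ennreal (C * \<epsilon>)"
    \<comment> \<open>The witness is fixed before \<open>\<epsilon>\<close> and \<open>U\<close>,
      and no \<open>\<epsilon>\<close> occurs in \<open>C1\<close>.\<close>
    proof (intro exI[of _ "C1 / (1 - sqrt \<alpha>)"] allI impI)
      fix \<epsilon> :: real and U :: "nat \<Rightarrow> nat \<Rightarrow> 'a \<Rightarrow> 'h"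
      assume eps: "\<epsilon> > 0"
        and run: "enkf_run \<Psi> H Hadj R r \<beta> N a \<epsilon> M U0 \<zeta> (\<lambda>j \<omega>. H (?u j) + \<epsilon> *\<^sub>R \<eta> j \<omega>) U"
      have path: "enkf_path H Hadj \<beta> \<Psi> R r L \<alpha> \<rho> b a \<epsilon> N ?u (\<lambda>j n. U j n \<omega>) (\<lambda>j n. \<zeta> j n \<omega>) (\<lambda>j. \<eta> j \<omega>)"
        if w: "\<omega> \<in> space M" for \<omega>
      proof -
        let ?v = "\<lambda>j n. \<Psi> (proj_BV r \<beta> (Hadj \<circ> H) (U j n \<omega>)) + sqrt a *\<^sub>R Hadj (\<zeta> (Suc j) n \<omega>)"
        let ?\<Sigma> = "\<lambda>j x. (1 / real N) *\<^sub>R outer_sum N (?v j) (emp_mean N (?v j)) x"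
        let ?K = "\<lambda>j. kalman_gain H Hadj R \<epsilon> (?\<Sigma> j)"
        have st: "emp_mean N (\<lambda>n. U (Suc j) n \<omega>) = emp_mean N (?v j)
            + ?K j (H (?u (Suc j)) + \<epsilon> *\<^sub>R \<eta> (Suc j) \<omega> - H (emp_mean N (?v j)))
          \<and> (\<forall>x. (1 / real (N - 1)) *\<^sub>R outer_sum N (\<lambda>n. U (Suc j) n \<omega>) (emp_mean N (\<lambda>n. U (Suc j) n \<omega>)) x
            = ?\<Sigma> j x - ?K j (H (?\<Sigma> j x)))" for j
        proof -
          have "1 \<le> Suc j" by simp
          from run[unfolded enkf_run_def Let_def, THEN conjunct2, THEN conjunct2, THEN spec, THEN mp, OF this, THEN bspec, OF w]
          show ?thesis unfolding diff_Suc_1 .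
        qed
        show ?thesis
          by (intro enkf_path.intro wo.weighted_observation_axioms enkf_path_axioms.intro A rho R_norm R_sym eps a N2
              st[THEN conjunct1] st[THEN conjunct2, THEN spec]) simp
      qed
      define X where "X j \<omega> = norm (wo.T (emp_mean N (\<lambda>n. U j n \<omega>) - ?u j))" for j \<omega>
      define e where "e j = (\<integral>\<^sup>+\<omega>. ennreal (X j \<omega>) \<partial>M)" for j
      have Xm: "X j \<in> borel_measurable M" for j
      proof -
        have "(\<lambda>\<omega>. emp_mean N (\<lambda>n. U j n \<omega>) - ?u j) \<in> borel_measurable M"
          unfolding emp_mean_def using run
          by (intro borel_measurable_diff borel_measurable_scaleR borel_measurable_sum) (auto simp: enkf_run_def)
        moreover have "(\<lambda>x. norm (wo.T x)) \<in> borel_measurable borel"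
          by (intro borel_measurable_continuous_onI continuous_on_norm wo.T.continuous_on continuous_on_id)
        ultimately show ?thesis unfolding X_def[abs_def] by (rule measurable_compose)
      qed
      \<comment> \<open>This time depends on \<open>\<epsilon>\<close>, which the limit superior
        does not see.\<close>
      obtain J0 where J0: "\<And>j. j \<ge> J0 \<Longrightarrow> \<alpha> ^ j * r\<^sup>2 \<le> \<epsilon>\<^sup>2"
      proof -
        have "(\<lambda>j. \<alpha> ^ j * r\<^sup>2) \<longlonglongrightarrow> 0 * r\<^sup>2"
          using par by (intro tendsto_intros LIMSEQ_realpow_zero) auto
        then have "\<forall>\<^sub>F j in sequentially. \<alpha> ^ j * r\<^sup>2 < \<epsilon>\<^sup>2" using eps by (intro order_tendstoD) auto
        then show ?thesis using that unfolding eventually_sequentially by (meson less_imp_le)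
      qed
      define J where "J = max T0 J0"
      obtain x where x: "0 \<le> x" "e (Suc J) \<le> ennreal x"
      proof -
        define F where "F = (r + sqrt (1 + \<beta>) * (\<epsilon> * (b / sqrt \<rho>))) / (\<epsilon> * sqrt \<rho>)"
        let ?p0 = "2 * r + sqrt (1 + \<beta>) * \<epsilon> + F * (\<epsilon> + 2 * r + sqrt a)"
          and ?p1 = "sqrt (1 + \<beta>) * \<epsilon> + F * \<epsilon>" and ?p2 = "F * sqrt a"
        have F0: "F \<ge> 0" unfolding F_def using par eps b0 rho(1) by simp
        then have p: "?p0 \<ge> 0" "?p1 \<ge> 0" "?p2 \<ge> 0" using par eps a by auto
        \<comment> \<open>The summand \<open>0 * 0\<close> fills the fourth slot of
          \<open>nn_integral_affine_le\<close>.\<close>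
        have "e (Suc J) \<le> (\<integral>\<^sup>+\<omega>. ennreal (?p0 + ?p1 * (norm (\<eta> (Suc J) \<omega>))\<^sup>2 + ?p2 * (\<Sum>n<N. (norm (\<zeta> (Suc J) n \<omega>))\<^sup>2) + 0 * 0) \<partial>M)"
          unfolding e_def
        proof (intro nn_integral_mono ennreal_leI)
          fix \<omega> assume w: "\<omega> \<in> space M"
          show "X (Suc J) \<omega> \<le> ?p0 + ?p1 * (norm (\<eta> (Suc J) \<omega>))\<^sup>2 + ?p2 * (\<Sum>n<N. (norm (\<zeta> (Suc J) n \<omega>))\<^sup>2) + 0 * 0"
            using enkf_path.error_crude[OF path[OF w] T0, of J] by (simp add: X_def F_def J_def)
        qed
        also have "\<dots> \<le> ennreal (?p0 + ?p1 * tr + ?p2 * (real N * ?k) + 0 * 0)"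
          using em[of "Suc J"] Zm[of "Suc J"] E_eta[of "Suc J"] E_zeta[of "Suc J"] p tr0
          by (intro nn_integral_affine_le) (auto intro: sum_nonneg)
        finally show ?thesis using p tr0 by (intro that[of "?p0 + ?p1 * tr + ?p2 * (real N * ?k) + 0 * 0"]) auto
      qed
      have rec: "e (Suc j) \<le> ennreal (sqrt \<alpha>) * e j + ennreal (\<epsilon> * C1)" if j: "Suc J \<le> j" for j
      proof -
        have ind: "indep_vars (\<lambda>_. borel) (\<zeta> (Suc j)) {..<N}"
          using indep zetam by (intro indep_inflation) auto
        have G: "gaussian_rv M (\<zeta> (Suc j) n) 0 id" if "n < N" for n using infl that by auto
        obtain W where W: "W \<in> borel_measurable M" "\<And>\<omega>. W \<omega> > 0"
          "(\<integral>\<^sup>+\<omega>. ennreal (W \<omega>) \<partial>M) \<le> ennreal ((7 * ?k) ^ 3)"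
          "\<And>\<omega> \<nu> c. (norm \<nu>)\<^sup>2 \<le> W \<omega> * (\<epsilon>\<^sup>2 * (norm \<nu>)\<^sup>2 + 2 * ?k\<^sup>2 * (\<Sum>n<N. (inner (\<zeta> (Suc j) n \<omega> - c) \<nu>)\<^sup>2))"
          \<comment> \<open>The floor is \<open>\<tau> = \<epsilon>\<close>, the size that the
            observation noise in the innovation covariance can absorb.\<close>
          using gaussian_gram_lower_bound[OF eps ind G N6k] by blast
        let ?Y = "\<lambda>\<omega>. (sqrt (\<alpha> * c) + E1 + 8 * r\<^sup>2 * E2) + E1 * (norm (\<eta> (Suc j) \<omega>))\<^sup>2
          + 2 * a * E2 * (\<Sum>n<N. (norm (\<zeta> (Suc j) n \<omega>))\<^sup>2) + E2 * W \<omega>"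
        have p0: "0 \<le> sqrt (\<alpha> * c) + E1 + 8 * r\<^sup>2 * E2" using par c0 E0 by simp
        have Y0: "?Y \<omega> \<ge> 0" for \<omega>
          using par c0 E0 a less_imp_le[OF W(2)[of \<omega>]] by (intro add_nonneg_nonneg mult_nonneg_nonneg sum_nonneg) auto
        have Ym: "?Y \<in> borel_measurable M"
          using em[of "Suc j"] Zm[of "Suc j"] W(1)
          by (intro borel_measurable_add borel_measurable_times borel_measurable_const) auto
        have EY: "(\<integral>\<^sup>+\<omega>. ennreal (?Y \<omega>) \<partial>M) \<le> ennreal C1"
          unfolding C1_def
          using em[of "Suc j"] Zm[of "Suc j"] E_eta[of "Suc j"] E_zeta[of "Suc j"] W(1,3) less_imp_le[OF W(2)] p0 E0 a tr0
          by (intro nn_integral_affine_le) (auto intro: sum_nonneg)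
        have "e (Suc j) \<le> (\<integral>\<^sup>+\<omega>. ennreal (sqrt \<alpha>) * ennreal (X j \<omega>) + ennreal \<epsilon> * ennreal (?Y \<omega>) \<partial>M)"
          unfolding e_def
        proof (rule nn_integral_mono)
          fix \<omega> assume w: "\<omega> \<in> space M"
          interpret enkf_path H Hadj \<beta> \<Psi> R r L \<alpha> \<rho> b a \<epsilon> N ?u "\<lambda>j n. U j n \<omega>" "\<lambda>j n. \<zeta> j n \<omega>" "\<lambda>j. \<eta> j \<omega>"
            "\<lambda>j n. \<Psi> (proj_BV r \<beta> (Hadj \<circ> H) (U j n \<omega>))"
            "\<lambda>j n. \<Psi> (proj_BV r \<beta> (Hadj \<circ> H) (U j n \<omega>)) + sqrt a *\<^sub>R Hadj (\<zeta> (Suc j) n \<omega>)"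
            "\<lambda>j. emp_mean N (\<lambda>n. \<Psi> (proj_BV r \<beta> (Hadj \<circ> H) (U j n \<omega>)) + sqrt a *\<^sub>R Hadj (\<zeta> (Suc j) n \<omega>))"
            "\<lambda>j x. (1 / real N) *\<^sub>R outer_sum N (\<lambda>n. \<Psi> (proj_BV r \<beta> (Hadj \<circ> H) (U j n \<omega>)) + sqrt a *\<^sub>R Hadj (\<zeta> (Suc j) n \<omega>))
               (emp_mean N (\<lambda>n. \<Psi> (proj_BV r \<beta> (Hadj \<circ> H) (U j n \<omega>)) + sqrt a *\<^sub>R Hadj (\<zeta> (Suc j) n \<omega>))) x"
            by (rule path[OF w])
          \<comment> \<open>\<open>S_bound\<close> counts from time 1, hence
            \<open>j = Suc i\<close> and the start of the recursion at \<open>Suc J\<close>.\<close>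
          obtain i where i: "j = Suc i" "i \<ge> J0" using j unfolding J_def by (cases j) auto
          have uj: "norm (?u j) \<le> r" using j by (intro T0) (auto simp: J_def)
          have "S j \<le> \<alpha> ^ i * r\<^sup>2 + (1 + \<beta>) * (\<epsilon>\<^sup>2 * tr) / (1 - \<alpha>)"
            using S_bound[of i] by (simp add: i(1) trR_def tr_def)
          also have "\<dots> \<le> \<epsilon>\<^sup>2 + (1 + \<beta>) * (\<epsilon>\<^sup>2 * tr) / (1 - \<alpha>)" using J0[OF i(2)] by simp
          also have "\<dots> = c * \<epsilon>\<^sup>2" by (simp add: c_def algebra_simps)
          finally have Sj: "S j \<le> c * \<epsilon>\<^sup>2" .
          have "X (Suc j) \<omega> \<le> sqrt \<alpha> * X j \<omega> + \<epsilon> * ?Y \<omega>"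
            unfolding X_def E1_def E2_def B_def D_def by (rule error_fine[OF uj c0 Sj W(2,4)])
          then show "ennreal (X (Suc j) \<omega>) \<le> ennreal (sqrt \<alpha>) * ennreal (X j \<omega>) + ennreal \<epsilon> * ennreal (?Y \<omega>)"
            using s(1) eps Y0[of \<omega>] X_def by (simp add: ennreal_mult[symmetric] ennreal_plus[symmetric] ennreal_leI del: ennreal_plus)
        qed
        also have "\<dots> = ennreal (sqrt \<alpha>) * e j + ennreal \<epsilon> * (\<integral>\<^sup>+\<omega>. ennreal (?Y \<omega>) \<partial>M)"
          unfolding e_def using Xm[of j] Ym
          by (subst nn_integral_add) (auto simp: nn_integral_cmult)
        also have "\<dots> \<le> ennreal (sqrt \<alpha>) * e j + ennreal \<epsilon> * ennreal C1"
          by (intro add_left_mono mult_left_mono EY) auto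
        finally show ?thesis using eps C10 by (simp add: ennreal_mult)
      qed
      have "limsup (\<lambda>j. \<integral>\<^sup>+ \<omega>. ennreal (norm (emp_mean N (\<lambda>n. U j n \<omega>) - ?u j)) \<partial>M) \<le> limsup e"
        unfolding e_def X_def
        by (intro Limsup_mono always_eventually allI nn_integral_mono ennreal_leI wo.norm_le_T)
      also have "\<dots> \<le> ennreal (\<epsilon> * C1 / (1 - sqrt \<alpha>))"
        using eps C10 by (intro limsup_affine_recursion[where e = e and J = "Suc J", OF s _ x rec]) auto
      finally show "limsup (\<lambda>j. \<integral>\<^sup>+ \<omega>. ennreal (norm (emp_mean N (\<lambda>n. U j n \<omega>) - ?u j)) \<partial>M)
          \<le> ennreal (C1 / (1 - sqrt \<alpha>) * \<epsilon>)" by (simp add: mult.commute)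
    qed
  qed simp
qed

end
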